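(* There is a unique hermitian structure $(\cdot,\cdot)$ on ${}_D\mathbf W$ such that $(\mathbf 1,\mathbf 1)=1$ and such that for all $\chi,\psi\in{}_D\mathbf W$: (i) for $z\in D$, as an equality of meromorphic sections of $K$ on $D$, $(\chi,e(z)\psi)=-C^*(i(C(z))\chi,\psi)$, or equivalently $u(z)^2(\chi,\hat e(z)\psi)=(\hat i(C(z))\chi,\psi)$; (ii) for $z'\in D'$, as an equality of meromorphic sections of $K$ on $D'$, $(\chi,i(z')\psi)=-C^*(e(C(z'))\chi,\psi)$, or equivalently $u(z')^2(\chi,\hat i(z')\psi)=(\hat e(C(z'))\chi,\psi)$.
   Context: $\mathbb P$ is a complex projective line with canonical bundle $K$, and $C:\mathbb P\to\mathbb P$ is an antiholomorphic involution given in a suitable coordinate $u$ (a meromorphic function with one simple pole) by $u(C(z))=1/\overline{u(z)}$. $P$ is the pole of $u$; $D'$ is the component of the complement of the fixed-point set of $C$ that contains $P$, and $D=C(D')$ is the other component, so $D=\{|u|<1\}$. ${}_D\mathbf K$ is the space of meromorphic 1-forms on $\mathbb P$ with all residues zero and all poles in $D$; ${}_D\mathbf W=S^*({}_D\mathbf K)$ is its symmetric algebra, with vacuum $\mathbf 1=1\in\mathbb C$. A hermitian structure is antilinear in the first argument and linear in the second. For $z\in D$, $e(z):{}_D\mathbf W\to{}_D\mathbf W\otimes K_z$ is multiplication by $e_z=-\frac{du}{(u-u(z))^2}\otimes du_z$, where $K_z$ is the fibre of $K$ at $z$. For $z\notin D$, $i(z):{}_D\mathbf W\to{}_D\mathbf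 W\otimes K_z$ is the derivation with $i(z)\mathbf 1=0$ and $i(z)\alpha=-\alpha(z)$ for $\alpha\in{}_D\mathbf K$. One writes $e(z)=\hat e(z)\,du_z$ and $i(z)=\hat i(z)\,du_z$. $C^*$ is pull-back by $C$, taking $(0,1)$-covectors at $C(z)$ to $(1,0)$-covectors at $z$.
   Formalization: Uniqueness is among hermitian structures for which pairing with e(z)ψ respects its Taylor expansion in z at each point of D; without this it fails, as adding conj(c(α))c(β), c(α)=Res_0 u²α, on one-forms preserves (i) and (ii). The hatted equivalences assume the same. *)

theory Defs
  imports
    "HOL-Complex_Analysis.Complex_Analysis"
    "HOL-Library.Poly_Mapping"
    "HOL-Library.Multiset"
begin

class complex_vector = ab_group_add +
  fixes cscale :: "complex \<Rightarrow> 'a \<Rightarrow> 'a"  (infixr \<open>*\<^sub>C\<close> 75)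
  assumes cscale_add_right: "c *\<^sub>C (x + y) = c *\<^sub>C x + c *\<^sub>C y"
    and cscale_add_left: "(c + d) *\<^sub>C x = c *\<^sub>C x + d *\<^sub>C x"
    and cscale_cscale: "c *\<^sub>C (d *\<^sub>C x) = (c * d) *\<^sub>C x"
    and cscale_one: "1 *\<^sub>C x = x"

abbreviation clinear :: "('a::complex_vector \<Rightarrow> 'b::complex_vector) \<Rightarrow> bool"
  where "clinear \<equiv> Vector_Spaces.linear (*\<^sub>C) (*\<^sub>C)"

text \<open>
  \<open>'v multiset \<Rightarrow>\<^sub>0 complex\<close> is the polynomial algebra with one variable for every vector; the
  symmetric algebra is its quotient by the ideal expressing that the map from vectors to
  variables is linear.
\<close>

inductive_set sym_ideal :: "('v::complex_vector multiset \<Rightarrow>\<^sub>0 complex) set" where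
  gen_add: "Poly_Mapping.single {#x + y#} 1 - Poly_Mapping.single {#x#} 1
              - Poly_Mapping.single {#y#} 1 \<in> sym_ideal"
| gen_scale: "Poly_Mapping.single {#c *\<^sub>C x#} 1 - Poly_Mapping.single {#x#} c \<in> sym_ideal"
| add: "p \<in> sym_ideal \<Longrightarrow> q \<in> sym_ideal \<Longrightarrow> p + q \<in> sym_ideal"
| mult: "q \<in> sym_ideal \<Longrightarrow> p * q \<in> sym_ideal"

lemma sym_ideal_zero: "0 \<in> sym_ideal"
  using sym_ideal.mult[OF sym_ideal.gen_add, of 0] by simp

lemma sym_ideal_uminus: "p \<in> sym_ideal \<Longrightarrow> - p \<in> sym_ideal"
  using sym_ideal.mult[of p "-1"] by simp

lemma sym_ideal_diff: "p \<in> sym_ideal \<Longrightarrow> q \<in> sym_ideal \<Longrightarrow> p - q \<in> sym_ideal"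
  using sym_ideal.add[OF _ sym_ideal_uminus[of q], of p] by simp

abbreviation (input) coef where "coef \<equiv> Poly_Mapping.lookup"

lemma lookup_times_zero_multiset:
  fixes p q :: "'v multiset \<Rightarrow>\<^sub>0 complex"
  shows "coef (p * q) 0 = coef p 0 * coef q 0"
proof -
  have 3: "(\<Sum>k. coef q k when 0 = l + k) = (coef q 0 when l = 0)"
    for l :: "'v multiset"
  proof -
    have "(\<Sum>k. coef q k when 0 = l + k) = (\<Sum>k. (coef q k when l = 0) when k = 0)"
      by (rule Sum_any.cong) (auto simp: when_def)
    also have "\<dots> = (coef q 0 when l = 0)"
      by (rule Sum_any_when_equal)
    finally show ?thesis .
  qed
  have "coef (p * q) 0 = (\<Sum>l. coef p l * (\<Sum>k. coef q k when 0 = l + k))"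
    by (simp add: lookup_mult)
  also have "\<dots> = (\<Sum>l. (coef p l * coef q 0) when l = 0)"
    unfolding 3 by (rule Sum_any.cong) (auto simp: when_def)
  also have "\<dots> = coef p 0 * coef q 0"
    by (rule Sum_any_when_equal)
  finally show ?thesis .
qed

lemma sym_ideal_lookup_zero: "p \<in> sym_ideal \<Longrightarrow> coef p 0 = 0"
  by (induction rule: sym_ideal.induct)
    (auto simp: lookup_minus lookup_add lookup_single lookup_times_zero_multiset when_def)

lemma one_notin_sym_ideal: "1 \<notin> sym_ideal"
  using sym_ideal_lookup_zero[of 1] by (auto simp: lookup_one)

definition sym_eq ::
    "('v::complex_vector multiset \<Rightarrow>\<^sub>0 complex) \<Rightarrow> ('v multiset \<Rightarrow>\<^sub>0 complex) \<Rightarrow> bool"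
  where "sym_eq p q \<longleftrightarrow> p - q \<in> sym_ideal"

lemma equivp_sym_eq:
  "equivp (sym_eq :: ('v::complex_vector multiset \<Rightarrow>\<^sub>0 complex) \<Rightarrow> _)" (is "equivp ?E")
proof (rule equivpI)
  show "reflp ?E"
    by (simp add: reflp_def sym_eq_def sym_ideal_zero)
  show "symp ?E"
    using sym_ideal_uminus by (fastforce simp: symp_def sym_eq_def)
  show "transp ?E"
  proof (rule transpI, unfold sym_eq_def)
    fix p q r :: "'v multiset \<Rightarrow>\<^sub>0 complex"
    assume "p - q \<in> sym_ideal" "q - r \<in> sym_ideal"
    then have "(p - q) + (q - r) \<in> sym_ideal" by (rule sym_ideal.add)
    then show "p - r \<in> sym_ideal" by simp
  qed
qed

quotient_type (overloaded) 'v symalg = "('v::complex_vector) multiset \<Rightarrow>\<^sub>0 complex" / sym_eq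
  by (rule equivp_sym_eq)

instantiation symalg :: (complex_vector) comm_ring_1
begin

lift_definition zero_symalg :: "'a symalg" is 0 .
lift_definition one_symalg :: "'a symalg" is 1 .
lift_definition plus_symalg :: "'a symalg \<Rightarrow> 'a symalg \<Rightarrow> 'a symalg" is "(+)"
  by (simp add: sym_eq_def add_diff_add sym_ideal.add)
lift_definition uminus_symalg :: "'a symalg \<Rightarrow> 'a symalg" is uminus
  by (simp only: sym_eq_def minus_diff_minus sym_ideal_uminus)
lift_definition minus_symalg :: "'a symalg \<Rightarrow> 'a symalg \<Rightarrow> 'a symalg" is "(-)"
proof (unfold sym_eq_def)
  fix p p' q q' :: "'a multiset \<Rightarrow>\<^sub>0 complex"
  assume "p - p' \<in> sym_ideal" "q - q' \<in> sym_ideal"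
  then have "(p - p') - (q - q') \<in> sym_ideal" by (rule sym_ideal_diff)
  then show "p - q - (p' - q') \<in> sym_ideal" by (simp add: algebra_simps)
qed
lift_definition times_symalg :: "'a symalg \<Rightarrow> 'a symalg \<Rightarrow> 'a symalg" is "(*)"
proof (unfold sym_eq_def)
  fix p p' q q' :: "'a multiset \<Rightarrow>\<^sub>0 complex"
  assume "p - p' \<in> sym_ideal" "q - q' \<in> sym_ideal"
  then have "q * (p - p') + p' * (q - q') \<in> sym_ideal" by (intro sym_ideal.intros)
  then show "p * q - p' * q' \<in> sym_ideal" by (simp add: algebra_simps)
qed

instance
proof
  fix a b c :: "'a symalg"
  have eqI: "p = q \<Longrightarrow> sym_eq p q" for p q :: "'a multiset \<Rightarrow>\<^sub>0 complex"
    by (simp add: sym_eq_def sym_ideal_zero)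
  show "a * b * c = a * (b * c)" by transfer (rule eqI, simp add: algebra_simps)
  show "a * b = b * a" by transfer (rule eqI, simp add: algebra_simps)
  show "1 * a = a" by transfer (rule eqI, simp)
  show "a + b + c = a + (b + c)" by transfer (rule eqI, simp add: algebra_simps)
  show "a + b = b + a" by transfer (rule eqI, simp add: algebra_simps)
  show "0 + a = a" by transfer (rule eqI, simp)
  show "- a + a = 0" by transfer (rule eqI, simp)
  show "a - b = a + - b" by transfer (rule eqI, simp)
  show "(a + b) * c = a * c + b * c" by transfer (rule eqI, simp add: algebra_simps)
  show "0 \<noteq> (1::'a symalg)"
  proof (transfer, rule notI)
    assume "sym_eq 0 (1 :: 'a multiset \<Rightarrow>\<^sub>0 complex)"
    then have "- (0 - 1 :: 'a multiset \<Rightarrow>\<^sub>0 complex) \<in> sym_ideal"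
      unfolding sym_eq_def by (rule sym_ideal_uminus)
    then show False by (simp add: one_notin_sym_ideal)
  qed
qed

end

instantiation symalg :: (complex_vector) complex_vector
begin

lift_definition cscale_symalg :: "complex \<Rightarrow> 'a symalg \<Rightarrow> 'a symalg"
  is "\<lambda>c p. Poly_Mapping.single 0 c * p"
  by (simp add: sym_eq_def sym_ideal.mult flip: right_diff_distrib)

instance
proof
  fix x y :: "'a symalg" and c d :: complex
  have eqI: "p = q \<Longrightarrow> sym_eq p q" for p q :: "'a multiset \<Rightarrow>\<^sub>0 complex"
    by (simp add: sym_eq_def sym_ideal_zero)
  show "c *\<^sub>C (x + y) = c *\<^sub>C x + c *\<^sub>C y" by transfer (rule eqI, simp add: algebra_simps)
  show "(c + d) *\<^sub>C x = c *\<^sub>C x + d *\<^sub>C x"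
    by transfer (rule eqI, simp add: single_add algebra_simps)
  show "c *\<^sub>C (d *\<^sub>C x) = (c * d) *\<^sub>C x"
    by transfer (rule eqI, simp add: mult_single flip: mult.assoc)
  show "1 *\<^sub>C x = x" by transfer (rule eqI, simp)
qed

end

lift_definition sym_of :: "'v::complex_vector \<Rightarrow> 'v symalg"
  is "\<lambda>x. Poly_Mapping.single {#x#} 1" .

text \<open>
  The coordinate \<open>u\<close> identifies the projective line with the Riemann sphere: \<open>Aff a\<close> is the point
  with \<open>u = a\<close>, and \<open>Infty\<close> is the pole of \<open>u\<close>. Near \<open>Infty\<close> the local coordinate is \<open>1/u\<close>.

  The fibre of the canonical bundle at a point is identified with the complex numbers by means
  of the frame \<open>du\<close> at \<open>Aff a\<close> and the frame \<open>d(1/u)\<close> at \<open>Infty\<close>. In the same way the fibre of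
  its complex conjugate is framed by the conjugates of these covectors.
\<close>

datatype pline = Aff complex | Infty

fun circle_refl :: "pline \<Rightarrow> pline" where
  "circle_refl (Aff a) = (if a = 0 then Infty else Aff (1 / cnj a))"
| "circle_refl Infty = Aff 0"

definition disc :: "pline set" where "disc = {Aff a | a. norm a < 1}"

definition disc' :: "pline set" where "disc' = circle_refl ` disc"

text \<open>
  Pull-back by \<open>circle_refl\<close> of the \<open>(0,1)\<close>-covector at \<open>circle_refl p\<close> with component \<open>c\<close>, as a
  \<open>(1,0)\<close>-covector at \<open>p\<close>. As \<open>cnj u \<circ> circle_refl = 1/u\<close>, the conjugate of \<open>du\<close> pulls back to
  \<open>d(1/u) = - du/u\<^sup>2\<close>, and the conjugate of \<open>d(1/u)\<close> pulls back to \<open>du\<close>.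
\<close>

fun circle_pullback :: "pline \<Rightarrow> complex \<Rightarrow> complex" where
  "circle_pullback (Aff a) c = (if a = 0 then c else - c / a\<^sup>2)"
| "circle_pullback Infty c = c"

text \<open>The form \<open>f du\<close> equals \<open>chart_inf f dw\<close> in terms of \<open>w = 1/u\<close>.\<close>

definition chart_inf :: "(complex \<Rightarrow> complex) \<Rightarrow> complex \<Rightarrow> complex"
  where "chart_inf f = (\<lambda>w. - f (1 / w) / w\<^sup>2)"

definition meromorphic_form :: "(complex \<Rightarrow> complex) \<Rightarrow> bool"
  where "meromorphic_form f \<longleftrightarrow> f meromorphic_on UNIV \<and> chart_inf f meromorphic_on {0}"

fun form_residue :: "(complex \<Rightarrow> complex) \<Rightarrow> pline \<Rightarrow> complex" where
  "form_residue f (Aff a) = residue f a"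
| "form_residue f Infty = residue (chart_inf f) 0"

fun form_pole :: "(complex \<Rightarrow> complex) \<Rightarrow> pline \<Rightarrow> bool" where
  "form_pole f (Aff a) = is_pole f a"
| "form_pole f Infty = is_pole (chart_inf f) 0"

definition meromorphic_section :: "pline set \<Rightarrow> (pline \<Rightarrow> complex) \<Rightarrow> bool"
  where "meromorphic_section S s \<longleftrightarrow>
    (\<lambda>a. s (Aff a)) meromorphic_on {a. Aff a \<in> S} \<and>
    (Infty \<in> S \<longrightarrow> chart_inf (\<lambda>a. s (Aff a)) meromorphic_on {0})"

definition section_eq :: "pline set \<Rightarrow> (pline \<Rightarrow> complex) \<Rightarrow> (pline \<Rightarrow> complex) \<Rightarrow> bool"
  where "section_eq S s t \<longleftrightarrow>
    meromorphic_section S s \<and> meromorphic_section S t \<and> (\<forall>p\<in>S. s p = t p)"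

definition form_K :: "(complex \<Rightarrow> complex) \<Rightarrow> bool"
  where "form_K f \<longleftrightarrow> meromorphic_form f \<and> (\<forall>p. form_residue f p = 0) \<and>
    (\<forall>p. form_pole f p \<longrightarrow> p \<in> disc)"

definition form_eq :: "(complex \<Rightarrow> complex) \<Rightarrow> (complex \<Rightarrow> complex) \<Rightarrow> bool"
  where "form_eq f g \<longleftrightarrow> form_K f \<and> form_K g \<and> (\<forall>\<^sub>\<approx>a. f a = g a)"

lemma residue_add_mero:
  assumes "f meromorphic_on {z}" "g meromorphic_on {z}"
  shows "residue (\<lambda>x. f x + g x) z = residue f z + residue g z"
proof -
  from assms obtain r s where r: "r > 0" "f analytic_on ball z r - {z}"
    and s: "s > 0" "g analytic_on ball z s - {z}"
    by (auto simp: meromorphic_at_iff isolated_singularity_at_def)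
  let ?B = "ball z (min r s)"
  show ?thesis
  proof (rule residue_add[of ?B])
    show "f holomorphic_on ?B - {z}" "g holomorphic_on ?B - {z}"
      by (rule holomorphic_on_subset[OF analytic_imp_holomorphic[OF r(2)]]; force)
         (rule holomorphic_on_subset[OF analytic_imp_holomorphic[OF s(2)]]; force)
  qed (use r s in auto)
qed

lemma residue_lmul_mero:
  assumes "f meromorphic_on {z}"
  shows "residue (\<lambda>x. c * f x) z = c * residue f z"
proof -
  from assms obtain r where r: "r > 0" "f analytic_on ball z r - {z}"
    by (auto simp: meromorphic_at_iff isolated_singularity_at_def)
  show ?thesis
    by (rule residue_lmul[of "ball z r"]) (use r analytic_imp_holomorphic in auto)
qed

lemma not_pole_limit:
  assumes "f meromorphic_on {z}" "\<not> is_pole f z"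
  obtains c where "f \<midarrow>z\<rightarrow> c"
proof -
  have "not_essential f z"
    using assms(1) by (simp add: meromorphic_at_iff)
  then obtain c where "f \<midarrow>z\<rightarrow> c"
    using assms(2) unfolding not_essential_def by blast
  then show thesis by (rule that)
qed

lemma not_pole_add:
  assumes "f meromorphic_on {z}" "g meromorphic_on {z}" "\<not> is_pole f z" "\<not> is_pole g z"
  shows "\<not> is_pole (\<lambda>x. f x + g x) z"
proof -
  obtain c d where "f \<midarrow>z\<rightarrow> c" "g \<midarrow>z\<rightarrow> d"
    using assms not_pole_limit by metis
  then have "(\<lambda>x. f x + g x) \<midarrow>z\<rightarrow> c + d" by (rule tendsto_add)
  then show ?thesis
    unfolding is_pole_def by (metis at_neq_bot not_tendsto_and_filterlim_at_infinity)
qed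

lemma not_pole_lmul:
  assumes "f meromorphic_on {z}" "\<not> is_pole f z"
  shows "\<not> is_pole (\<lambda>x. a * f x) z"
proof -
  obtain c where "f \<midarrow>z\<rightarrow> c"
    using assms not_pole_limit by metis
  then have "(\<lambda>x. a * f x) \<midarrow>z\<rightarrow> a * c" by (rule tendsto_mult_left)
  then show ?thesis
    unfolding is_pole_def by (metis at_neq_bot not_tendsto_and_filterlim_at_infinity)
qed

lemma chart_inf_add: "chart_inf (\<lambda>x. f x + g x) = (\<lambda>w. chart_inf f w + chart_inf g w)"
  by (auto simp: chart_inf_def fun_eq_iff add_divide_distrib diff_divide_distrib)

lemma chart_inf_lmul: "chart_inf (\<lambda>x. c * f x) = (\<lambda>w. c * chart_inf f w)"
  by (auto simp: chart_inf_def fun_eq_iff)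

lemma form_K_add:
  assumes "form_K f" "form_K g"
  shows "form_K (\<lambda>x. f x + g x)"
proof -
  have m: "f meromorphic_on {z}" "g meromorphic_on {z}"
      "chart_inf f meromorphic_on {0}" "chart_inf g meromorphic_on {0}" for z
    using assms by (auto simp: form_K_def meromorphic_form_def intro: meromorphic_on_subset)
  have "form_residue (\<lambda>x. f x + g x) p = form_residue f p + form_residue g p" for p
    by (cases p) (simp_all add: residue_add_mero m chart_inf_add)
  moreover have "form_pole f p \<or> form_pole g p" if "form_pole (\<lambda>x. f x + g x) p" for p
    using that not_pole_add[OF m(1,2)] not_pole_add[OF m(3,4)]
    by (cases p) (auto simp: chart_inf_add)
  moreover have "meromorphic_form (\<lambda>x. f x + g x)"
    using assms by (auto simp: form_K_def meromorphic_form_def chart_inf_add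
        intro!: meromorphic_intros)
  ultimately show ?thesis
    using assms unfolding form_K_def by (metis add.left_neutral)
qed

lemma form_K_lmul:
  assumes "form_K f"
  shows "form_K (\<lambda>x. c * f x)"
proof -
  have m: "f meromorphic_on {z}" "chart_inf f meromorphic_on {0}" for z
    using assms by (auto simp: form_K_def meromorphic_form_def intro: meromorphic_on_subset)
  have "form_residue (\<lambda>x. c * f x) p = c * form_residue f p" for p
    by (cases p) (simp_all add: residue_lmul_mero m chart_inf_lmul)
  moreover have "form_pole f p" if "form_pole (\<lambda>x. c * f x) p" for p
    using that not_pole_lmul[OF m(1)] not_pole_lmul[OF m(2)]
    by (cases p) (auto simp: chart_inf_lmul)
  moreover have "meromorphic_form (\<lambda>x. c * f x)"
    using assms by (auto simp: form_K_def meromorphic_form_def chart_inf_lmul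
        intro!: meromorphic_intros)
  ultimately show ?thesis
    using assms by (auto simp: form_K_def)
qed

lemma form_K_zero: "form_K (\<lambda>_. 0)"
proof -
  have chart: "chart_inf (\<lambda>_. 0) = (\<lambda>_. 0)"
    by (simp add: chart_inf_def)
  have "\<not> is_pole (\<lambda>_::complex. 0::complex) z" for z
    unfolding is_pole_def
    by (rule notI, rule not_tendsto_and_filterlim_at_infinity[OF at_neq_bot tendsto_const])
  then have "\<not> form_pole (\<lambda>_. 0) p" for p
    by (cases p) (simp_all add: chart)
  moreover have "form_residue (\<lambda>_. 0) p = 0" for p
    by (cases p) (simp_all add: chart residue_const)
  moreover have "meromorphic_form (\<lambda>_. 0)"
    unfolding meromorphic_form_def chart by (intro conjI meromorphic_on_const)
  ultimately show ?thesis
    by (simp add: form_K_def)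
qed

lemma part_equivp_form_eq: "part_equivp form_eq"
proof (rule part_equivpI)
  show "\<exists>f. form_eq f f"
    using form_K_zero by (auto simp: form_eq_def)
  show "symp form_eq"
    by (auto simp: symp_def form_eq_def elim: eventually_mono)
  show "transp form_eq"
    by (auto simp: transp_def form_eq_def elim: eventually_elim2)
qed

quotient_type form = "complex \<Rightarrow> complex" / partial: form_eq
  by (rule part_equivp_form_eq)

instantiation form :: complex_vector
begin

lift_definition zero_form :: form is "\<lambda>_. 0"
  by (simp add: form_eq_def form_K_zero)
lift_definition plus_form :: "form \<Rightarrow> form \<Rightarrow> form" is "\<lambda>f g x. f x + g x"
  by (auto simp: form_eq_def form_K_add elim: eventually_elim2)
lift_definition cscale_form :: "complex \<Rightarrow> form \<Rightarrow> form" is "\<lambda>c f x. c * f x"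
  by (auto simp: form_eq_def form_K_lmul elim: eventually_mono)
definition uminus_form :: "form \<Rightarrow> form" where "uminus_form \<alpha> = (-1) *\<^sub>C \<alpha>"
definition minus_form :: "form \<Rightarrow> form \<Rightarrow> form" where "minus_form \<alpha> \<beta> = \<alpha> + - \<beta>"

instance
proof
  fix a b c :: form and x y :: complex
  have eqI: "form_eq f g" if "form_K f" "f = g" for f g
    using that by (simp add: form_eq_def)
  have D: "form_K f" if "form_eq f f" for f
    using that by (simp add: form_eq_def)
  show "a + b + c = a + (b + c)"
    by transfer (rule eqI, intro form_K_add D, assumption+, simp add: add.assoc)
  show "a + b = b + a"
    by transfer (rule eqI, intro form_K_add D, assumption+, simp add: add.commute)
  show "0 + a = a"
    by transfer simp
  show "- a + a = 0" unfolding uminus_form_def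
    by transfer (rule eqI, intro form_K_add form_K_lmul D, assumption+, simp)
  show "a - b = a + - b"
    by (simp add: minus_form_def)
  show "x *\<^sub>C (a + b) = x *\<^sub>C a + x *\<^sub>C b"
    by transfer (rule eqI, intro form_K_add form_K_lmul D, assumption+, simp add: ring_distribs)
  show "(x + y) *\<^sub>C a = x *\<^sub>C a + y *\<^sub>C a"
    by transfer (rule eqI, rule form_K_lmul, rule D, assumption, simp add: ring_distribs)
  show "x *\<^sub>C (y *\<^sub>C a) = (x * y) *\<^sub>C a"
    by transfer (rule eqI, rule form_K_lmul, rule form_K_lmul, rule D, assumption,
        simp add: mult.assoc)
  show "1 *\<^sub>C a = a"
    by transfer simp
qed

end

text \<open>
  Coefficients in the frames above; \<open>remove_sings\<close> picks the holomorphic representative near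
  points that are not poles.
\<close>

lift_definition coeff_u :: "form \<Rightarrow> complex \<Rightarrow> complex" is remove_sings
  by (rule ext, rule remove_sings_cong)
     (auto simp: form_eq_def eventually_cosparse_open_eq)

fun form_at :: "form \<Rightarrow> pline \<Rightarrow> complex" where
  "form_at \<alpha> (Aff a) = coeff_u \<alpha> a"
| "form_at \<alpha> Infty = remove_sings (chart_inf (coeff_u \<alpha>)) 0"

text \<open>
  \<open>e_form n a\<close> is \<open>1/n!\<close> times the \<open>n\<close>-th derivative with respect to \<open>a\<close> of \<open>- du/(u - a)\<^sup>2\<close>.
  It is meaningful for \<open>norm a < 1\<close> only, by the following lemma.
\<close>

lemma form_K_e_form:
  assumes "norm a < 1"
  shows "form_K (\<lambda>x. - of_nat (n + 1) / (x - a) ^ (n + 2))" (is "form_K ?f")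
proof -
  define c :: complex where "c = - of_nat (n + 1)"
  define g where "g = (\<lambda>w. - c * w ^ n / (1 - a * w) ^ (n + 2))"
  have c: "?f = (\<lambda>x. c / (x - a) ^ (n + 2))"
    by (simp add: c_def)
  have eq: "chart_inf ?f w = g w" if "w \<noteq> 0" for w
  proof -
    have "1 / w - a = (1 - a * w) / w"
      using that by (simp add: field_simps)
    then show ?thesis
      using that unfolding c by (simp add: chart_inf_def g_def power_divide power_add
          power2_eq_square)
  qed
  have ev: "\<forall>\<^sub>F w in at 0. chart_inf ?f w = g w"
    using eq by (auto simp: eventually_at_filter)
  have g: "g analytic_on {0}"
    unfolding g_def by (intro analytic_intros) auto
  have np: "\<not> is_pole k z" if "k analytic_on {z}" for k z
    using that analytic_at_imp_no_pole by blast
  have "meromorphic_form ?f"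
    unfolding meromorphic_form_def
  proof
    show "?f meromorphic_on UNIV" by (intro meromorphic_intros)
    show "chart_inf ?f meromorphic_on {0}"
      by (subst meromorphic_on_cong[where g = g])
        (use ev g analytic_on_imp_meromorphic_on in auto)
  qed
  moreover have an: "?f analytic_on {z}" if "z \<noteq> a" for z
    using that by (intro analytic_intros) auto
  moreover have "form_residue ?f p = 0" for p
  proof (cases p)
    case (Aff z)
    have "residue ?f z = 0"
    proof (cases "z = a")
      case True
      have "residue (\<lambda>x. (\<lambda>_. c) x / (x - a) ^ Suc (Suc n)) a
          = (deriv ^^ Suc n) (\<lambda>_. c) a / fact (Suc n)"
        by (rule residue_holomorphic_over_power[of UNIV]) auto
      moreover have "(deriv ^^ Suc n) (\<lambda>_. c) a = 0"
        by (subst higher_deriv_const) auto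
      ultimately show ?thesis using True by (simp add: c_def)
    next
      case False
      then obtain r where "r > 0" "?f holomorphic_on ball z r"
        using an[OF False] by (metis analytic_at_ball)
      then show ?thesis by (intro residue_holo[of "ball z r"]) auto
    qed
    then show ?thesis using Aff by simp
  next
    case Infty
    obtain r where "r > 0" "g holomorphic_on ball 0 r"
      using g by (metis analytic_at_ball)
    then have "residue g 0 = 0" by (intro residue_holo[of "ball 0 r"]) auto
    then show ?thesis using Infty residue_cong[OF ev refl] by simp
  qed
  moreover have "p \<in> disc" if "form_pole ?f p" for p
  proof (cases p)
    case (Aff z)
    then have "z = a" using that an np by (metis form_pole.simps(1))
    then show ?thesis using Aff assms by (auto simp: disc_def)
  next
    case Infty
    then have "is_pole g 0" using that is_pole_cong[OF ev refl] by simp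
    then show ?thesis using np g by blast
  qed
  ultimately show ?thesis
    unfolding form_K_def by blast
qed

definition e_form :: "nat \<Rightarrow> complex \<Rightarrow> form"
  where "e_form n a = abs_form (\<lambda>x. - of_nat (n + 1) / (x - a) ^ (n + 2))"

type_synonym fock = "form symalg"

text \<open>
  \<open>e_op\<close> and \<open>i_op\<close> are given by their components in the frame at the point concerned; at \<open>Aff a\<close>
  these are the operators written with a hat.
\<close>

definition e_coeff :: "nat \<Rightarrow> complex \<Rightarrow> fock \<Rightarrow> fock"
  where "e_coeff n a \<psi> = sym_of (e_form n a) * \<psi>"

fun e_op :: "pline \<Rightarrow> fock \<Rightarrow> fock" where
  "e_op (Aff a) \<psi> = e_coeff 0 a \<psi>"
| "e_op Infty \<psi> = undefined"

definition derivation :: "(fock \<Rightarrow> fock) \<Rightarrow> bool"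
  where "derivation d \<longleftrightarrow> clinear d \<and> (\<forall>\<phi> \<psi>. d (\<phi> * \<psi>) = d \<phi> * \<psi> + \<phi> * d \<psi>)"

definition i_op :: "pline \<Rightarrow> fock \<Rightarrow> fock"
  where "i_op p = (THE d. derivation d \<and> d 1 = 0 \<and>
    (\<forall>\<alpha>. d (sym_of \<alpha>) = (- form_at \<alpha> p) *\<^sub>C 1))"

definition hermitian_structure :: "(fock \<Rightarrow> fock \<Rightarrow> complex) \<Rightarrow> bool"
  where "hermitian_structure h \<longleftrightarrow>
    (\<forall>\<phi> \<psi> \<psi>'. h \<phi> (\<psi> + \<psi>') = h \<phi> \<psi> + h \<phi> \<psi>') \<and>
    (\<forall>c \<phi> \<psi>. h \<phi> (c *\<^sub>C \<psi>) = c * h \<phi> \<psi>) \<and>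
    (\<forall>\<phi> \<phi>' \<psi>. h (\<phi> + \<phi>') \<psi> = h \<phi> \<psi> + h \<phi>' \<psi>) \<and>
    (\<forall>c \<phi> \<psi>. h (c *\<^sub>C \<phi>) \<psi> = cnj c * h \<phi> \<psi>) \<and>
    (\<forall>\<phi> \<psi>. h \<psi> \<phi> = cnj (h \<phi> \<psi>))"

text \<open>
  For \<open>(\<phi>, e(z)\<psi>)\<close> to be the section obtained by pairing \<open>\<phi>\<close> with the section \<open>e(z)\<psi>\<close>, the pairing
  has to respect the Taylor expansion of \<open>e(z)\<psi>\<close> at every point of the disc. Values alone are not
  enough: the forms \<open>e\<^sub>z\<close> have double poles and span a proper subspace, so that equalities of
  values leave the pairing of two forms with poles of order at least three undetermined.
\<close>

definition pairs_e_sections :: "(fock \<Rightarrow> fock \<Rightarrow> complex) \<Rightarrow> bool"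
  where "pairs_e_sections h \<longleftrightarrow> (\<forall>\<phi> \<psi> a. norm a < 1 \<longrightarrow>
    (\<lambda>t. h \<phi> (e_coeff 0 (a + t) \<psi>)) has_fps_expansion Abs_fps (\<lambda>n. h \<phi> (e_coeff n a \<psi>)))"

text \<open>
  As \<open>h\<close> is antilinear in its first argument, \<open>h (i_op (circle_refl z) \<phi>) \<psi>\<close> is the component of a
  \<open>(0,1)\<close>-covector at \<open>circle_refl z\<close>. The versions with hats are about the points \<open>Aff a\<close> with \<open>u = a\<close>;
  the zero and the pole of \<open>u\<close> are left out, since \<open>du\<close> is not a frame at the pole.
\<close>

definition cond_e :: "(fock \<Rightarrow> fock \<Rightarrow> complex) \<Rightarrow> fock \<Rightarrow> fock \<Rightarrow> bool"
  where "cond_e h \<phi> \<psi> \<longleftrightarrow> section_eq disc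
    (\<lambda>z. h \<phi> (e_op z \<psi>)) (\<lambda>z. - circle_pullback z (h (i_op (circle_refl z) \<phi>) \<psi>))"

definition cond_e_hat :: "(fock \<Rightarrow> fock \<Rightarrow> complex) \<Rightarrow> fock \<Rightarrow> fock \<Rightarrow> bool"
  where "cond_e_hat h \<phi> \<psi> \<longleftrightarrow> (\<forall>a. Aff a \<in> disc \<and> a \<noteq> 0 \<longrightarrow>
    a\<^sup>2 * h \<phi> (e_op (Aff a) \<psi>) = h (i_op (circle_refl (Aff a)) \<phi>) \<psi>)"

definition cond_i :: "(fock \<Rightarrow> fock \<Rightarrow> complex) \<Rightarrow> fock \<Rightarrow> fock \<Rightarrow> bool"
  where "cond_i h \<phi> \<psi> \<longleftrightarrow> section_eq disc'
    (\<lambda>z. h \<phi> (i_op z \<psi>)) (\<lambda>z. - circle_pullback z (h (e_op (circle_refl z) \<phi>) \<psi>))"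

definition cond_i_hat :: "(fock \<Rightarrow> fock \<Rightarrow> complex) \<Rightarrow> fock \<Rightarrow> fock \<Rightarrow> bool"
  where "cond_i_hat h \<phi> \<psi> \<longleftrightarrow> (\<forall>a. Aff a \<in> disc' \<longrightarrow>
    a\<^sup>2 * h \<phi> (i_op (Aff a) \<psi>) = h (e_op (circle_refl (Aff a)) \<phi>) \<psi>)"

end

theory Submission
  imports Defs
begin

text \<open>
  Put \<open>w = 1/u\<close>. A form \<open>\<alpha>\<close> in \<open>K\<close> has no poles in the closed disc \<open>|w| \<le> 1\<close>, and its coefficient
  \<open>g\<^sub>\<alpha>\<close> with respect to \<open>dw\<close> is holomorphic there. Let \<open>J(w)\<close> be the derivation of \<open>Sym K\<close> that
  sends \<open>\<alpha>\<close> to \<open>g\<^sub>\<alpha>(w)\<close>. It is \<open>i(z)\<close> at the point \<open>z\<close> with \<open>1/u = w\<close>, up to the factor that relates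
  the frames. With it, condition (i) becomes
  \<open>(\<phi>, e\<^sub>a \<psi>) = (J(cnj a) \<phi>, \<psi>)\<close> for \<open>|a| < 1\<close>, without exception at \<open>a = 0\<close> (\<open>cond_e_iff\<close>).
  Condition (ii) is the same equation conjugated and with \<open>\<phi>\<close> and \<open>\<psi>\<close> exchanged (\<open>cond_i_iff\<close>). The
  versions with hats omit \<open>a = 0\<close> only, which is recovered by continuity (\<open>cond_e_iff_hat\<close>).

  Uniqueness. The forms \<open>e\<^sub>a\<close> and their Taylor coefficients in \<open>a\<close> span \<open>K\<close>: subtracting principal
  parts, which contain no simple poles as the residues vanish, leaves a form without poles, and
  this is zero by Liouville's theorem (\<open>form_induct\<close>). So condition (i) determines \<open>(\<phi>, v \<psi>)\<close> for
  every form \<open>v\<close> from the values \<open>(\<phi>', \<psi>)\<close>, and induction leads down to \<open>(1, 1)\<close>.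

  Existence. For one-forms the condition asks that \<open>(\<alpha>, e\<^sub>a)\<close> be the conjugate of
  \<open>g\<^sub>\<alpha>(cnj a)\<close>. As the coefficient of \<open>e\<^sub>a\<close> is \<open>1/(1 - a w)\<^sup>2\<close>, the Bergman kernel of the disc, this
  is the reproducing property of the Bergman inner product. Written as a series in the Taylor
  coefficients at \<open>w = 0\<close>, it is manifestly hermitian and also pairs correctly with the Taylor
  coefficients of \<open>e\<^sub>a\<close> (\<open>form_pairing_has_fps_expansion\<close>). A hermitian form on any vector space
  \<open>V\<close> extends to \<open>Sym V\<close> in such a way that multiplication by \<open>x\<close> is adjoint to the contraction
  with \<open>(x, \<cdot>)\<close>; for \<open>x = e\<^sub>a\<close> this contraction is \<open>J(cnj a)\<close>.
\<close>

section \<open>Linear maps on the symmetric algebra\<close>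

instantiation complex :: complex_vector
begin
definition cscale_complex :: "complex \<Rightarrow> complex \<Rightarrow> complex" where "cscale_complex = (*)"
instance by standard (simp_all add: cscale_complex_def algebra_simps)
end

lemma vector_space_cscale: "vector_space ((*\<^sub>C) :: complex \<Rightarrow> 'a::complex_vector \<Rightarrow> 'a)"
  by standard (simp_all add: cscale_add_right cscale_add_left cscale_cscale cscale_one)

lemma clinearI:
  assumes "\<And>x y. f (x + y) = f x + f y" "\<And>c x. f (c *\<^sub>C x) = c *\<^sub>C f x"
  shows "clinear f"
  using assms by (simp add: Vector_Spaces.linear_def module_hom_def module_hom_axioms_def
      module_iff_vector_space vector_space_cscale)

lemma clinear_add: "clinear f \<Longrightarrow> f (x + y) = f x + f y"
  by (simp add: Vector_Spaces.linear_def module_hom_def module_hom_axioms_def)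

lemma clinear_scale: "clinear f \<Longrightarrow> f (c *\<^sub>C x) = c *\<^sub>C f x"
  by (simp add: Vector_Spaces.linear_def module_hom_def module_hom_axioms_def)

lemma clinear_0: "clinear f \<Longrightarrow> f 0 = 0"
  using clinear_add[of f 0 0] by simp

lemma cscale_0_left: "0 *\<^sub>C (x::'a::complex_vector) = 0"
  using cscale_add_left[of 0 0 x] by simp

lemma cscale_0_right: "c *\<^sub>C (0::'a::complex_vector) = 0"
  using cscale_add_right[of c 0 "0::'a"] by simp

lemma cscale_times_left: "(c *\<^sub>C x) * y = c *\<^sub>C (x * (y :: 'v::complex_vector symalg))"
  by transfer (simp add: sym_eq_def sym_ideal_zero mult.assoc)

lemma cscale_times_right: "x * (c *\<^sub>C y) = c *\<^sub>C (x * (y :: 'v::complex_vector symalg))"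
  by (metis cscale_times_left mult.commute)

lemma sym_of_add: "sym_of (x + y) = sym_of x + sym_of y"
proof transfer
  fix x y :: 'a
  show "sym_eq (Poly_Mapping.single {#x + y#} 1)
      (Poly_Mapping.single {#x#} 1 + Poly_Mapping.single {#y#} 1)"
    using sym_ideal.gen_add[of x y] by (simp add: sym_eq_def algebra_simps)
qed

lemma sym_of_scale: "sym_of (c *\<^sub>C x) = c *\<^sub>C sym_of x"
proof transfer
  fix x :: 'a and c
  show "sym_eq (Poly_Mapping.single {#c *\<^sub>C x#} 1)
      (Poly_Mapping.single 0 c * Poly_Mapping.single {#x#} 1)"
    using sym_ideal.gen_scale[of c x] by (simp add: sym_eq_def mult_single)
qed

definition sym_monom :: "'v::complex_vector multiset \<Rightarrow> 'v symalg"
  where "sym_monom m = prod_mset (image_mset sym_of m)"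

lemma sym_monom_empty [simp]: "sym_monom {#} = 1"
  and sym_monom_add_mset [simp]: "sym_monom (add_mset x m) = sym_of x * sym_monom m"
  by (simp_all add: sym_monom_def)

lemma abs_symalg_single_one: "abs_symalg (Poly_Mapping.single m 1) = sym_monom m"
proof (induction m)
  case empty
  then show ?case by (simp add: one_symalg_def)
next
  case (add x m)
  have "abs_symalg (Poly_Mapping.single (add_mset x m) 1)
      = abs_symalg (Poly_Mapping.single {#x#} 1 * Poly_Mapping.single m 1)"
    by (simp add: mult_single)
  also have "\<dots> = sym_of x * sym_monom m"
    by (simp add: times_symalg.abs_eq[symmetric] sym_of.abs_eq[symmetric] add)
  finally show ?case by simp
qed

lemma abs_symalg_single: "abs_symalg (Poly_Mapping.single m c) = c *\<^sub>C sym_monom m"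
proof -
  have "Poly_Mapping.single m c = Poly_Mapping.single 0 c * Poly_Mapping.single m 1"
    by (simp add: mult_single)
  then show ?thesis
    by (simp add: cscale_symalg.abs_eq[symmetric] abs_symalg_single_one[symmetric])
qed

lemma poly_mapping_single_induct [case_names zero single add]:
  assumes "P 0" "\<And>m c. P (Poly_Mapping.single m c)" "\<And>p q. P p \<Longrightarrow> P q \<Longrightarrow> P (p + q)"
  shows "P (p :: 'a \<Rightarrow>\<^sub>0 'b::comm_monoid_add)"
proof -
  have "P (\<Sum>m\<in>S. Poly_Mapping.single m (coef p m))" if "finite S" for S
    using that by (induction) (auto intro: assms)
  moreover have "p = (\<Sum>m\<in>Poly_Mapping.keys p. Poly_Mapping.single m (coef p m))"
    by (rule poly_mapping_eqI) (auto simp: lookup_sum lookup_single when_def in_keys_iff)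
  ultimately show ?thesis
    by (metis finite_keys)
qed

lemma symalg_induct_monom [case_names monom add scale]:
  assumes "\<And>m. P (sym_monom m)" "\<And>x y. P x \<Longrightarrow> P y \<Longrightarrow> P (x + y)" "\<And>c x. P x \<Longrightarrow> P (c *\<^sub>C x)"
  shows "P (x :: 'v::complex_vector symalg)"
proof (induction x rule: symalg.abs_induct)
  case (1 p)
  have "P (0 *\<^sub>C sym_monom {#})" by (intro assms)
  then have 0: "P 0" by (simp add: cscale_0_left)
  show ?case
    by (induction p rule: poly_mapping_single_induct)
      (auto simp: abs_symalg_single plus_symalg.abs_eq[symmetric] zero_symalg_def[symmetric] 0
        intro: assms)
qed

lemma symalg_induct [case_names one gen add scale]:
  assumes "P 1" "\<And>v x. P x \<Longrightarrow> P (sym_of v * x)" "\<And>x y. P x \<Longrightarrow> P y \<Longrightarrow> P (x + y)"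
    "\<And>c x. P x \<Longrightarrow> P (c *\<^sub>C x)"
  shows "P (x :: 'v::complex_vector symalg)"
proof (induction x rule: symalg_induct_monom)
  case (monom m)
  show ?case by (induction m) (auto intro: assms)
qed (auto intro: assms)

text \<open>
  A function of multisets of vectors that is linear in each entry extends linearly to the symmetric
  algebra. Two kinds of maps arise from this below: contractions, with values in the algebra, and
  the hermitian form, with values in \<open>\<complex>\<close>, for which \<open>\<complex>\<close> is made a complex vector space.
\<close>

definition multilinear :: "('v::complex_vector multiset \<Rightarrow> 'b::complex_vector) \<Rightarrow> bool"
  where "multilinear g \<longleftrightarrow> (\<forall>m. clinear (\<lambda>x. g (add_mset x m)))"

definition poly_lift :: "('v multiset \<Rightarrow> 'b::complex_vector) \<Rightarrow> ('v multiset \<Rightarrow>\<^sub>0 complex) \<Rightarrow> 'b"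
  where "poly_lift g p = (\<Sum>m\<in>Poly_Mapping.keys p. coef p m *\<^sub>C g m)"

lemma poly_lift_superset:
  assumes "finite S" "Poly_Mapping.keys p \<subseteq> S"
  shows "poly_lift g p = (\<Sum>m\<in>S. coef p m *\<^sub>C g m)"
  unfolding poly_lift_def using assms
  by (intro sum.mono_neutral_left) (auto simp: in_keys_iff cscale_0_left)

lemma poly_lift_0: "poly_lift g 0 = 0"
  by (simp add: poly_lift_def)

lemma poly_lift_single: "poly_lift g (Poly_Mapping.single m c) = c *\<^sub>C g m"
  by (subst poly_lift_superset[of "{m}"]) (auto simp: lookup_single)

lemma poly_lift_add: "poly_lift g (p + q) = poly_lift g p + poly_lift g q"
proof -
  let ?S = "Poly_Mapping.keys p \<union> Poly_Mapping.keys q"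
  have "Poly_Mapping.keys (p + q) \<subseteq> ?S" by (rule Poly_Mapping.keys_add)
  then show ?thesis
    by (subst (1 2 3) poly_lift_superset[of ?S])
      (auto simp: lookup_add cscale_add_left sum.distrib)
qed

lemma poly_lift_scale: "poly_lift g (Poly_Mapping.single 0 c * p) = c *\<^sub>C poly_lift g p"
proof (induction p rule: poly_mapping_single_induct)
  case zero
  show ?case by (simp add: poly_lift_def cscale_0_right)
next
  case (single m d)
  show ?case by (simp add: mult_single poly_lift_single cscale_cscale)
next
  case (add p q)
  then show ?case by (simp add: distrib_left poly_lift_add cscale_add_right)
qed

lemma poly_lift_diff: "poly_lift g (p - q) = poly_lift g p - poly_lift g q"
  using poly_lift_add[of g "p - q" q] by (simp add: algebra_simps)

text \<open>
  The factor \<open>p\<close> is carried along so that the induction over the ideal survives the closure of the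
  ideal under multiplication.
\<close>

lemma poly_lift_sym_ideal:
  assumes g: "multilinear g" and "q \<in> sym_ideal"
  shows "poly_lift g (p * q) = 0"
  using assms(2)
proof (induction arbitrary: p)
  have lin: "clinear (\<lambda>x. g (add_mset x m))" for m
    using g by (simp add: multilinear_def)
  {
    case (gen_add x y)
    show ?case
    proof (induction p rule: poly_mapping_single_induct)
      case (single m c)
      show ?case
        by (simp add: right_diff_distrib mult_single poly_lift_single poly_lift_diff
            clinear_add[OF lin] cscale_add_right)
    qed (simp_all add: poly_lift_0 distrib_right poly_lift_add)
  next
    case (gen_scale c x)
    show ?case
    proof (induction p rule: poly_mapping_single_induct)
      case (single m d)
      show ?case
        by (simp add: right_diff_distrib mult_single poly_lift_single poly_lift_diff
            clinear_scale[OF lin] cscale_cscale)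
    qed (simp_all add: poly_lift_0 distrib_right poly_lift_add)
  next
    case (add q r)
    then show ?case by (simp add: distrib_left poly_lift_add)
  next
    case (mult q r)
    then show ?case by (simp flip: mult.assoc)
  }
qed

definition sym_lift :: "('v::complex_vector multiset \<Rightarrow> 'b::complex_vector) \<Rightarrow> 'v symalg \<Rightarrow> 'b"
  where "sym_lift g x = poly_lift g (rep_symalg x)"

lemma sym_lift_abs:
  assumes "multilinear g"
  shows "sym_lift g (abs_symalg p) = poly_lift g p"
proof -
  have "sym_eq (rep_symalg (abs_symalg p)) p"
    using Quotient3_rep_abs[OF Quotient3_symalg] equivp_reflp[OF equivp_sym_eq]
    by metis
  then have "poly_lift g (1 * (rep_symalg (abs_symalg p) - p)) = 0"
    by (intro poly_lift_sym_ideal assms) (simp add: sym_eq_def)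
  then show ?thesis by (simp add: sym_lift_def poly_lift_diff)
qed

lemma sym_lift_monom:
  assumes "multilinear g"
  shows "sym_lift g (sym_monom m) = g m"
  using sym_lift_abs[OF assms, of "Poly_Mapping.single m 1"]
  by (simp add: abs_symalg_single_one poly_lift_single cscale_one)

lemma clinear_sym_lift:
  assumes "multilinear g"
  shows "clinear (sym_lift g)"
proof (rule clinearI)
  fix x y :: "'a symalg" and c
  show "sym_lift g (x + y) = sym_lift g x + sym_lift g y"
    by (induction x rule: symalg.abs_induct, induction y rule: symalg.abs_induct)
      (simp add: plus_symalg.abs_eq sym_lift_abs[OF assms] poly_lift_add)
  show "sym_lift g (c *\<^sub>C x) = c *\<^sub>C sym_lift g x"
    by (induction x rule: symalg.abs_induct)
      (simp add: cscale_symalg.abs_eq sym_lift_abs[OF assms] poly_lift_scale)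
qed

section \<open>Contractions\<close>

text \<open>
  Contraction with a functional \<open>l\<close> is the derivation extending it. On a monomial it removes each
  factor in turn; existence of the derivation is the multilinearity of this expression.
\<close>

definition contract_monom :: "('v::complex_vector \<Rightarrow> complex) \<Rightarrow> 'v multiset \<Rightarrow> 'v symalg"
  where "contract_monom l m = (\<Sum>x\<in>#m. l x *\<^sub>C sym_monom (m - {#x#}))"

lemma contract_monom_add_mset:
  "contract_monom l (add_mset x m) = l x *\<^sub>C sym_monom m + sym_of x * contract_monom l m"
proof -
  have "(\<Sum>y\<in>#m. l y *\<^sub>C sym_monom (add_mset x m - {#y#}))
      = (\<Sum>y\<in>#m. sym_of x * (l y *\<^sub>C sym_monom (m - {#y#})))"
    by (intro arg_cong[where f = sum_mset] image_mset_cong)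
      (auto simp: cscale_times_right simp flip: sym_monom_add_mset)
  then show ?thesis
    by (simp add: contract_monom_def sum_mset_distrib_left)
qed

lemma multilinear_contract_monom:
  assumes "clinear l"
  shows "multilinear (contract_monom l)"
  unfolding multilinear_def contract_monom_add_mset
  by (intro allI clinearI)
    (simp_all add: clinear_add[OF assms] clinear_scale[OF assms] sym_of_add sym_of_scale
      cscale_add_left cscale_add_right distrib_right cscale_times_left cscale_cscale
      cscale_complex_def)

definition contract :: "('v::complex_vector \<Rightarrow> complex) \<Rightarrow> 'v symalg \<Rightarrow> 'v symalg"
  where "contract l = sym_lift (contract_monom l)"

lemma clinear_contract: "clinear l \<Longrightarrow> clinear (contract l)"
  unfolding contract_def by (intro clinear_sym_lift multilinear_contract_monom)

lemmas contract_add = clinear_add[OF clinear_contract]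
  and contract_scale = clinear_scale[OF clinear_contract]
  and contract_0 = clinear_0[OF clinear_contract]

lemma contract_monom_eq: "clinear l \<Longrightarrow> contract l (sym_monom m) = contract_monom l m"
  unfolding contract_def by (intro sym_lift_monom multilinear_contract_monom)

lemma contract_one: "clinear l \<Longrightarrow> contract l 1 = 0"
  using contract_monom_eq[of l "{#}"] by (simp add: contract_monom_def)

lemma contract_gen:
  assumes "clinear l"
  shows "contract l (sym_of v * x) = l v *\<^sub>C x + sym_of v * contract l x"
proof (induction x rule: symalg_induct_monom)
  case (monom m)
  show ?case
    using contract_monom_eq[OF assms, of "add_mset v m"]
    by (simp add: contract_monom_eq assms contract_monom_add_mset)
qed (simp_all add: distrib_left contract_add contract_scale assms cscale_add_right
      cscale_times_right cscale_cscale mult.commute)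

lemma contract_times:
  assumes "clinear l"
  shows "contract l (x * y) = contract l x * y + x * contract l y"
  by (induction x rule: symalg_induct)
    (simp_all add: contract_one contract_gen contract_add contract_scale assms distrib_right
      distrib_left cscale_add_right cscale_times_left mult.assoc)

text \<open>
  Both orders annihilate \<open>1\<close>, and on \<open>v x\<close> the product rule gives the mixed terms
  \<open>l v\<close> times \<open>contract l' x\<close> and \<open>l' v\<close> times \<open>contract l x\<close> in either order.
\<close>

lemma contract_commute:
  assumes "clinear l" "clinear l'"
  shows "contract l (contract l' x) = contract l' (contract l x)"
  by (induction x rule: symalg_induct)
    (simp_all add: contract_one contract_0 contract_gen contract_add contract_scale assms)

lemma derivation_eqI:
  assumes "clinear d" "\<And>\<phi> \<psi>. d (\<phi> * \<psi>) = d \<phi> * \<psi> + \<phi> * d \<psi>" "d 1 = 0"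
    "\<And>v. d (sym_of v) = l v *\<^sub>C 1" "clinear l"
  shows "d = contract l"
proof
  fix x
  show "d x = contract l x"
    by (induction x rule: symalg_induct)
      (simp_all add: assms contract_one contract_gen contract_add contract_scale
        clinear_add[OF assms(1)] clinear_scale[OF assms(1)] cscale_times_left)
qed

lemma contract_add_functional:
  assumes "clinear l" "clinear l'"
  shows "contract (\<lambda>v. l v + l' v) x = contract l x + contract l' x"
proof -
  have "clinear (\<lambda>v. l v + l' v)"
    by (rule clinearI) (simp_all add: clinear_add[OF assms(1)] clinear_scale[OF assms(1)]
      clinear_add[OF assms(2)] clinear_scale[OF assms(2)] cscale_complex_def algebra_simps)
  then show ?thesis
    by (induction x rule: symalg_induct)
      (simp_all add: contract_one contract_gen contract_add contract_scale assms
        cscale_add_left cscale_add_right distrib_left)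
qed

lemma clinear_scaled:
  fixes l :: "'v::complex_vector \<Rightarrow> complex"
  assumes "clinear l"
  shows "clinear (\<lambda>v. c * l v)"
  by (rule clinearI) (simp_all add: clinear_add[OF assms] clinear_scale[OF assms]
      cscale_complex_def algebra_simps)

lemma contract_scale_functional:
  assumes "clinear l"
  shows "contract (\<lambda>v. c * l v) x = c *\<^sub>C contract l x"
proof (induction x rule: symalg_induct)
  case (scale d x)
  then show ?case
    by (simp add: contract_scale assms clinear_scaled cscale_cscale mult.commute)
qed (simp_all add: contract_one contract_gen contract_add assms clinear_scaled cscale_0_right
      cscale_cscale cscale_add_right cscale_times_right)

section \<open>The Fock space of a hermitian space\<close>

lift_definition vac :: "'v::complex_vector symalg \<Rightarrow> complex" is "\<lambda>p. coef p 0"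
  unfolding sym_eq_def by (metis sym_ideal_lookup_zero lookup_minus eq_iff_diff_eq_0)

lemma clinear_vac: "clinear vac"
proof (rule clinearI)
  show "vac (x + y) = vac x + vac y" for x y :: "'a symalg"
    by transfer (simp add: lookup_add)
  show "vac (c *\<^sub>C x) = c *\<^sub>C vac x" for c and x :: "'a symalg"
    by transfer (simp add: lookup_times_zero_multiset cscale_complex_def)
qed

lemma vac_one [simp]: "vac 1 = 1"
  by transfer (simp add: lookup_one)

lemma vac_gen [simp]: "vac (sym_of v * x) = 0"
  by transfer (simp add: lookup_times_zero_multiset lookup_single)

text \<open>
  The form on \<open>V\<close> extends to \<open>Sym V\<close> by making multiplication by \<open>x\<close> adjoint to the contraction
  \<open>a(x)\<close> with \<open>k x\<close>: the pairing of \<open>x\<^sub>1 \<dots> x\<^sub>n\<close> with \<open>\<psi>\<close> is the degree zero component of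
  \<open>a(x\<^sub>1) \<dots> a(x\<^sub>n) \<psi>\<close>. This is a function of the multiset because contractions commute, and it is
  antilinear in each \<open>x\<^sub>i\<close>.
\<close>

locale hermitian_space =
  fixes k :: "'v::complex_vector \<Rightarrow> 'v \<Rightarrow> complex"
  assumes lin: "clinear (k x)" and herm: "k y x = cnj (k x y)"
begin

sublocale comp_fun_commute "\<lambda>x. contract (k x)"
  by standard (simp add: fun_eq_iff contract_commute lin)

abbreviation contract_all :: "'v multiset \<Rightarrow> 'v symalg \<Rightarrow> 'v symalg"
  where "contract_all m \<psi> \<equiv> fold_mset (\<lambda>x. contract (k x)) \<psi> m"

lemma add_left: "k (x + y) v = k x v + k y v"
  by (metis clinear_add complex_cnj_add herm lin)

lemma scale_left: "k (c *\<^sub>C x) v = cnj c * k x v"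
  by (metis clinear_scale complex_cnj_mult herm lin cscale_complex_def)

lemma contract_all_add_mset:
  "contract_all (add_mset x m) \<psi> = contract_all m (contract (k x) \<psi>)"
  by (simp add: fold_mset_fun_left_comm)

lemma clinear_contract_all: "clinear (contract_all m)"
proof (induction m)
  case empty
  show ?case by (rule clinearI) simp_all
next
  case (add x m)
  show ?case
    by (rule clinearI)
      (simp_all add: clinear_add[OF add] clinear_scale[OF add] contract_add contract_scale lin)
qed

text \<open>
  The conjugate makes the dependence on the entries of \<open>m\<close> linear, so that \<open>sym_lift\<close> applies.
\<close>

definition fock_monom :: "'v symalg \<Rightarrow> 'v multiset \<Rightarrow> complex"
  where "fock_monom \<psi> m = cnj (vac (contract_all m \<psi>))"

lemma multilinear_fock_monom: "multilinear (fock_monom \<psi>)"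
proof -
  note L = clinear_add[OF clinear_contract_all] clinear_scale[OF clinear_contract_all]
    clinear_add[OF clinear_vac] clinear_scale[OF clinear_vac]
  have k: "k (x + y) = (\<lambda>v. k x v + k y v)" "k (c *\<^sub>C x) = (\<lambda>v. cnj c * k x v)" for x y c
    by (simp_all add: fun_eq_iff add_left scale_left)
  show ?thesis
    unfolding multilinear_def fock_monom_def contract_all_add_mset k
    by (intro allI clinearI) (simp_all add: k contract_add_functional[OF lin lin] contract_scale_functional[OF lin] L
          cscale_complex_def)
qed

definition fock_form :: "'v symalg \<Rightarrow> 'v symalg \<Rightarrow> complex"
  where "fock_form \<phi> \<psi> = cnj (sym_lift (fock_monom \<psi>) \<phi>)"

lemma fock_form_monom: "fock_form (sym_monom m) \<psi> = vac (contract_all m \<psi>)"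
  by (simp add: fock_form_def sym_lift_monom multilinear_fock_monom fock_monom_def)

lemma fock_form_add_left: "fock_form (\<phi> + \<phi>') \<psi> = fock_form \<phi> \<psi> + fock_form \<phi>' \<psi>"
  and fock_form_scale_left: "fock_form (c *\<^sub>C \<phi>) \<psi> = cnj c * fock_form \<phi> \<psi>"
  by (simp_all add: fock_form_def clinear_add[OF clinear_sym_lift[OF multilinear_fock_monom]]
      clinear_scale[OF clinear_sym_lift[OF multilinear_fock_monom]] cscale_complex_def)

lemma fock_form_add_right: "fock_form \<phi> (\<psi> + \<psi>') = fock_form \<phi> \<psi> + fock_form \<phi> \<psi>'"
  and fock_form_scale_right: "fock_form \<phi> (c *\<^sub>C \<psi>) = c * fock_form \<phi> \<psi>"
  by (induction \<phi> rule: symalg_induct_monom)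
    (simp_all add: fock_form_monom clinear_add[OF clinear_contract_all]
      clinear_scale[OF clinear_contract_all] clinear_add[OF clinear_vac]
      clinear_scale[OF clinear_vac] fock_form_add_left fock_form_scale_left cscale_complex_def
      algebra_simps)

lemma fock_form_0_right: "fock_form \<phi> 0 = 0"
  using fock_form_add_right[of \<phi> 0 0] by simp

lemma fock_form_one_left: "fock_form 1 \<psi> = vac \<psi>"
  using fock_form_monom[of "{#}"] by simp

lemma fock_form_gen_left: "fock_form (sym_of v * \<phi>) \<psi> = fock_form \<phi> (contract (k v) \<psi>)"
proof (induction \<phi> rule: symalg_induct_monom)
  case (monom m)
  show ?case
    using fock_form_monom[of "add_mset v m"]
    by (simp add: fock_form_monom fold_mset_fun_left_comm)
qed (simp_all add: distrib_left fock_form_add_left fock_form_scale_left cscale_times_right)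

lemma fock_form_one_right: "fock_form \<phi> 1 = cnj (vac \<phi>)"
proof (induction \<phi> rule: symalg_induct)
  case (scale c \<phi>)
  then show ?case
    by (simp add: fock_form_scale_left clinear_scale[OF clinear_vac] cscale_complex_def)
qed (simp_all add: fock_form_one_left fock_form_gen_left contract_one lin fock_form_add_left
      clinear_add[OF clinear_vac] fock_form_0_right)

text \<open>
  This is the other half of the adjointness, and hermitian symmetry follows from the two halves. By
  the product rule, moving \<open>w\<close> and \<open>v\<close> across the form in the two possible orders leaves the terms
  \<open>k w v\<close> and the conjugate of \<open>k v w\<close>; they agree because \<open>k\<close> is hermitian.
\<close>

lemma fock_form_gen_right: "fock_form \<phi> (sym_of v * \<psi>) = fock_form (contract (k v) \<phi>) \<psi>"
proof (induction \<phi> arbitrary: \<psi> rule: symalg_induct)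
  case one
  show ?case
    using fock_form_scale_left[of 0 "1"]
    by (simp add: fock_form_one_left contract_one lin cscale_0_left)
next
  case (gen w \<phi>)
  have "fock_form (sym_of w * \<phi>) (sym_of v * \<psi>)
      = k w v * fock_form \<phi> \<psi> + fock_form \<phi> (sym_of v * contract (k w) \<psi>)"
    by (simp add: fock_form_gen_left contract_gen lin fock_form_add_right fock_form_scale_right)
  also have "\<dots> = cnj (k v w) * fock_form \<phi> \<psi> + fock_form (sym_of w * contract (k v) \<phi>) \<psi>"
    by (simp add: gen fock_form_gen_left herm[of w v])
  finally show ?case
    by (simp add: contract_gen lin fock_form_add_left fock_form_scale_left)
qed (simp_all add: fock_form_add_left fock_form_scale_left contract_add contract_scale lin)

lemma fock_form_hermitian: "fock_form \<psi> \<phi> = cnj (fock_form \<phi> \<psi>)"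
  by (induction \<phi> arbitrary: \<psi> rule: symalg_induct)
    (simp_all add: fock_form_one_left fock_form_one_right fock_form_gen_left fock_form_gen_right
      fock_form_add_left fock_form_scale_left fock_form_add_right fock_form_scale_right)

end

section \<open>Forms near infinity\<close>

lemma form_obtain_rep:
  obtains f where "form_K f" "\<alpha> = abs_form f"
  using Quotient3_abs_rep[OF Quotient3_form] Quotient3_rep_reflp[OF Quotient3_form]
  by (metis form_eq_def)

lemma form_eq_refl: "form_K f \<Longrightarrow> form_eq f f"
  by (simp add: form_eq_def)

text \<open>
  In the chart \<open>w = 1/u\<close> a form of the space \<open>K\<close> has no poles on the closed unit disc, which is
  the complement of \<open>D\<close>. Its coefficient there is \<open>inf_coeff\<close>, and it carries all values of the
  form that the operators \<open>i(z)\<close> use.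
\<close>

definition inf_coeff :: "form \<Rightarrow> complex \<Rightarrow> complex"
  where "inf_coeff \<alpha> = remove_sings (chart_inf (coeff_u \<alpha>))"

lemma coeff_u_abs: "form_K f \<Longrightarrow> coeff_u (abs_form f) = remove_sings f"
  by (simp add: coeff_u.abs_eq form_eq_refl)

lemma analytic_at_one_over:
  assumes "g analytic_on {1 / w}" "w \<noteq> (0::complex)"
  shows "(\<lambda>x. g (1 / x)) analytic_on {w}"
proof -
  have "(\<lambda>x. 1 / x) analytic_on {w}"
    using assms by (intro analytic_intros) auto
  from analytic_on_compose_gen[OF this assms(1)] show ?thesis
    by (simp add: o_def)
qed

lemma filterlim_one_over_at:
  assumes "w \<noteq> (0::complex)"
  shows "filterlim (\<lambda>x. 1 / x) (at (1 / w)) (at w)"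
proof (rule filterlim_atI)
  show "((\<lambda>x. 1 / x) \<longlongrightarrow> 1 / w) (at w)"
    using assms by (intro tendsto_intros)
  have "\<forall>\<^sub>F x in at w. x \<noteq> w" by (simp add: eventually_at_filter)
  then show "\<forall>\<^sub>F x in at w. 1 / x \<noteq> 1 / w"
    by eventually_elim (use assms in \<open>auto simp: field_simps\<close>)
qed

text \<open>
  For \<open>w \<noteq> 0\<close> this is the isolatedness of singularities at \<open>1/w\<close>. At \<open>w = 0\<close> it is meromorphy in
  the chart that makes \<open>f\<close> analytic in a punctured neighbourhood of infinity.
\<close>

lemma chart_inf_remove_sings_ev:
  assumes "form_K f"
  shows "\<forall>\<^sub>F x in at w. chart_inf (remove_sings f) x = chart_inf f x"
proof (cases "w = 0")
  case True
  have "chart_inf f meromorphic_on {0}"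
    using assms by (simp add: form_K_def meromorphic_form_def)
  then have "\<forall>\<^sub>F x in at 0. chart_inf f analytic_on {x}"
    by (rule eventually_cosparse_imp_eventually_at[OF meromorphic_on_imp_analytic_cosparse]) simp
  moreover have "\<forall>\<^sub>F x in at (0::complex). x \<noteq> 0" by (simp add: eventually_at_filter)
  ultimately have "\<forall>\<^sub>F x in at 0. chart_inf (remove_sings f) x = chart_inf f x"
  proof eventually_elim
    case (elim x)
    then have "(\<lambda>y. chart_inf f (1 / y)) analytic_on {1 / x}"
      by (intro analytic_at_one_over) auto
    then have "(\<lambda>y. - chart_inf f (1 / y) / y\<^sup>2) analytic_on {1 / x}"
      using elim by (intro analytic_intros) auto
    moreover have "\<forall>\<^sub>F y in nhds (1 / x). y \<noteq> 0"
      using elim by (intro t1_space_nhds) auto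
    then have "\<forall>\<^sub>F y in nhds (1 / x). - chart_inf f (1 / y) / y\<^sup>2 = f y"
      by eventually_elim (simp add: chart_inf_def power_divide)
    ultimately have "f analytic_on {1 / x}"
      using analytic_at_cong[OF _ refl] by metis
    then show ?case by (simp add: chart_inf_def)
  qed
  then show ?thesis using True by simp
next
  case False
  have "f meromorphic_on {1 / w}"
    using assms by (auto simp: form_K_def meromorphic_form_def intro: meromorphic_on_subset)
  then have "isolated_singularity_at f (1 / w)"
    by (simp add: meromorphic_at_iff)
  then have "\<forall>\<^sub>F y in at (1 / w). remove_sings f y = f y"
    by (rule eventually_remove_sings_eq_at)
  then have "\<forall>\<^sub>F x in at w. remove_sings f (1 / x) = f (1 / x)"
    using filterlim_one_over_at[OF False] by (rule eventually_compose_filterlim)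
  then show ?thesis
    by eventually_elim (simp add: chart_inf_def)
qed

lemma form_K_pole_norm: "form_K f \<Longrightarrow> is_pole f a \<Longrightarrow> norm a < 1"
  unfolding form_K_def disc_def by (auto dest: spec[of _ "Aff a"])

lemma form_K_no_pole_infinity: "form_K f \<Longrightarrow> \<not> is_pole (chart_inf f) 0"
  unfolding form_K_def disc_def by (auto dest: spec[of _ Infty])

lemma coeff_u_analytic_outside:
  assumes "norm a \<ge> 1"
  shows "coeff_u \<alpha> analytic_on {a}"
proof -
  obtain f where f: "form_K f" "\<alpha> = abs_form f" by (rule form_obtain_rep)
  then have m: "f meromorphic_on {a}"
    by (auto simp: form_K_def meromorphic_form_def intro: meromorphic_on_subset)
  moreover have "\<not> is_pole f a"
    using form_K_pole_norm[OF f(1)] assms by fastforce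
  ultimately obtain c where "f \<midarrow>a\<rightarrow> c" by (rule not_pole_limit)
  then show ?thesis
    using f m by (auto simp: coeff_u_abs meromorphic_at_iff intro: remove_sings_analytic_at)
qed

lemma chart_inf_coeff_u_analytic:
  assumes "w \<noteq> 0" "norm w \<le> 1"
  shows "chart_inf (coeff_u \<alpha>) analytic_on {w}"
proof -
  have "coeff_u \<alpha> analytic_on {1 / w}"
    using assms by (intro coeff_u_analytic_outside) (simp add: norm_divide field_simps)
  then have "(\<lambda>x. coeff_u \<alpha> (1 / x)) analytic_on {w}"
    using assms(1) by (rule analytic_at_one_over)
  then show ?thesis
    unfolding chart_inf_def using assms by (intro analytic_intros) auto
qed

lemma inf_coeff_nonzero:
  assumes "w \<noteq> 0" "norm w \<le> 1"
  shows "inf_coeff \<alpha> w = - coeff_u \<alpha> (1 / w) / w\<^sup>2"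
  using chart_inf_coeff_u_analytic[OF assms] by (simp add: inf_coeff_def chart_inf_def)

lemma coeff_u_inf_coeff:
  assumes "norm a \<ge> 1"
  shows "coeff_u \<alpha> a = - inf_coeff \<alpha> (1 / a) / a\<^sup>2"
proof -
  have "a \<noteq> 0" using assms by auto
  then show ?thesis
    using inf_coeff_nonzero[of "1 / a" \<alpha>] assms by (auto simp: norm_divide power_divide)
qed

text \<open>
  Elements of \<open>form\<close> are functions up to a sparse set, so \<open>inf_coeff\<close> is handled as a limit of the
  chart coefficient of any representative; linearity then follows from uniqueness of limits.
\<close>

lemma chart_inf_tendsto_inf_coeff:
  assumes f: "form_K f" and w: "norm w \<le> 1"
  shows "chart_inf f \<midarrow>w\<rightarrow> inf_coeff (abs_form f) w"
    and inf_coeff_analytic_aux: "inf_coeff (abs_form f) analytic_on {w}"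
proof -
  let ?F = "remove_sings f"
  note ev = chart_inf_remove_sings_ev[OF f, of w]
  have "isolated_singularity_at (chart_inf ?F) w \<and> (\<exists>c. chart_inf ?F \<midarrow>w\<rightarrow> c)"
  proof (cases "w = 0")
    case True
    have m: "chart_inf f meromorphic_on {0}"
      using f by (simp add: form_K_def meromorphic_form_def)
    then obtain c where "chart_inf f \<midarrow>0\<rightarrow> c"
      using form_K_no_pole_infinity[OF f] by (rule not_pole_limit)
    then have "chart_inf ?F \<midarrow>0\<rightarrow> c"
      using tendsto_cong[OF ev] True by simp
    moreover have "isolated_singularity_at (chart_inf ?F) w"
      using isolated_singularity_at_cong[OF ev refl] m True by (simp add: meromorphic_at_iff)
    ultimately show ?thesis using True by auto
  next
    case False
    then have "chart_inf ?F analytic_on {w}"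
      using chart_inf_coeff_u_analytic[OF False w, of "abs_form f"] f by (simp add: coeff_u_abs)
    then show ?thesis
      by (meson analytic_at_imp_isCont isContD isolated_singularity_at_analytic)
  qed
  then obtain c where iso: "isolated_singularity_at (chart_inf ?F) w" and c: "chart_inf ?F \<midarrow>w\<rightarrow> c"
    by auto
  have "inf_coeff (abs_form f) = remove_sings (chart_inf ?F)"
    by (simp add: inf_coeff_def coeff_u_abs f)
  then show "inf_coeff (abs_form f) analytic_on {w}" "chart_inf f \<midarrow>w\<rightarrow> inf_coeff (abs_form f) w"
    using remove_sings_analytic_at[OF iso c] c remove_sings_eqI[OF c] tendsto_cong[OF ev]
    by auto
qed

lemma inf_coeff_analytic: "inf_coeff \<alpha> analytic_on cball 0 1"
  by (rule form_obtain_rep[of \<alpha>], subst analytic_on_analytic_at) (auto intro: inf_coeff_analytic_aux)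

lemma inf_coeff_eqI:
  assumes "form_K f" "norm w \<le> 1" "chart_inf f \<midarrow>w\<rightarrow> c"
  shows "inf_coeff (abs_form f) w = c"
  using chart_inf_tendsto_inf_coeff(1)[OF assms(1,2)] assms(3) LIM_unique by blast

lemma inf_coeff_add:
  assumes "norm w \<le> 1"
  shows "inf_coeff (\<alpha> + \<beta>) w = inf_coeff \<alpha> w + inf_coeff \<beta> w"
proof -
  obtain f g where f: "form_K f" "\<alpha> = abs_form f" and g: "form_K g" "\<beta> = abs_form g"
    by (metis form_obtain_rep)
  then have "\<alpha> + \<beta> = abs_form (\<lambda>x. f x + g x)"
    by (simp add: plus_form.abs_eq form_eq_refl)
  then show ?thesis
    using f g assms by (auto intro!: inf_coeff_eqI form_K_add tendsto_add
        chart_inf_tendsto_inf_coeff simp: chart_inf_add)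
qed

lemma inf_coeff_scale:
  assumes "norm w \<le> 1"
  shows "inf_coeff (c *\<^sub>C \<alpha>) w = c * inf_coeff \<alpha> w"
proof -
  obtain f where f: "form_K f" "\<alpha> = abs_form f"
    by (metis form_obtain_rep)
  then have "c *\<^sub>C \<alpha> = abs_form (\<lambda>x. c * f x)"
    by (simp add: cscale_form.abs_eq form_eq_refl)
  then show ?thesis
    using f assms by (auto intro!: inf_coeff_eqI form_K_lmul tendsto_mult_left
        chart_inf_tendsto_inf_coeff simp: chart_inf_lmul)
qed

lemma clinear_inf_coeff: "norm w \<le> 1 \<Longrightarrow> clinear (\<lambda>\<alpha>. inf_coeff \<alpha> w)"
  by (rule clinearI) (simp_all add: inf_coeff_add inf_coeff_scale cscale_complex_def)

text \<open>
  For \<open>n = 0\<close> this is \<open>1 / (1 - a w)\<^sup>2\<close>, up to the factor \<open>\<pi>\<close> the Bergman kernel of the disc.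
\<close>

lemma inf_coeff_e_form:
  assumes "norm a < 1" "norm w \<le> 1"
  shows "inf_coeff (e_form n a) w = of_nat (n + 1) * w ^ n / (1 - a * w) ^ (n + 2)"
proof -
  let ?f = "\<lambda>x. - of_nat (n + 1) / (x - a) ^ (n + 2)"
  define g where "g = (\<lambda>w. of_nat (n + 1) * w ^ n / (1 - a * w) ^ (n + 2))"
  have aw: "norm (a * w) < 1"
    using assms by (metis mult_less_cancel_right2 mult.commute norm_mult norm_ge_zero
        order_le_less_trans mult_left_le)
  have "chart_inf ?f x = g x" if "x \<noteq> 0" for x
  proof -
    have "1 / x - a = (1 - a * x) / x"
      using that by (simp add: field_simps)
    then show ?thesis
      using that
      by (simp add: chart_inf_def g_def power_divide power_add power2_eq_square del: of_nat_Suc of_nat_add)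
  qed
  moreover have "\<forall>\<^sub>F x in at w. x \<noteq> 0"
    by (rule eventually_neq_at_within)
  ultimately have ev: "\<forall>\<^sub>F x in at w. chart_inf ?f x = g x"
    by (auto elim: eventually_mono)
  have "1 - a * w \<noteq> 0" using aw by auto
  then have "g \<midarrow>w\<rightarrow> g w"
    unfolding g_def by (intro tendsto_intros) auto
  then have "chart_inf ?f \<midarrow>w\<rightarrow> g w"
    using tendsto_cong[OF ev] by blast
  then show ?thesis
    using inf_coeff_eqI[OF form_K_e_form[OF assms(1), of n] assms(2)]
    by (simp add: e_form_def g_def)
qed

section \<open>Partial fractions\<close>

lemma form_K_poles_finite:
  assumes "form_K f"
  shows "finite {z. is_pole f z}"
proof -
  have "f meromorphic_on cball 0 1"
    using assms by (auto simp: form_K_def meromorphic_form_def intro: meromorphic_on_subset)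
  then have "finite (cball 0 1 \<inter> {w. \<not> f analytic_on {w}})"
    by (intro sparse_in_compact_finite meromorphic_on_imp_sparse_singularities compact_cball)
  moreover have "{z. is_pole f z} \<subseteq> cball 0 1 \<inter> {w. \<not> f analytic_on {w}}"
    using form_K_pole_norm[OF assms] analytic_at_imp_no_pole by (auto simp: less_imp_le)
  ultimately show ?thesis by (rule rev_finite_subset)
qed

definition polar_part :: "(nat \<Rightarrow> complex) \<Rightarrow> nat \<Rightarrow> complex \<Rightarrow> complex \<Rightarrow> complex"
  where "polar_part c N a x = (\<Sum>n<N. c n * (- of_nat (n + 1) / (x - a) ^ (n + 2)))"

lemma form_K_polar_part:
  assumes "norm a < 1"
  shows "form_K (polar_part c N a)"
proof (induction N)
  case 0
  show ?case by (simp add: polar_part_def[abs_def] form_K_zero)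
next
  case (Suc N)
  have "polar_part c (Suc N) a = (\<lambda>x. polar_part c N a x
      + c N * (- of_nat (N + 1) / (x - a) ^ (N + 2)))"
    by (simp add: polar_part_def fun_eq_iff)
  then show ?case
    using form_K_add[OF Suc form_K_lmul[OF form_K_e_form[OF assms]]] by simp
qed

lemma polar_part_not_pole:
  assumes "z \<noteq> a"
  shows "\<not> is_pole (polar_part c N a) z"
proof -
  have "polar_part c N a analytic_on {z}"
    unfolding polar_part_def[abs_def] using assms by (intro analytic_intros) auto
  then show ?thesis by (rule analytic_at_imp_no_pole)
qed

text \<open>
  The principal part at \<open>a\<close> is a combination of powers of exponent at most \<open>-2\<close>, since the
  coefficient of \<open>1/(x - a)\<close> is the residue, which vanishes.
\<close>

lemma polar_part_exists:
  assumes f: "form_K f" and a: "norm a < 1"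
  obtains c N where "\<not> is_pole (\<lambda>x. f x + (-1) * polar_part c N a x) a"
proof -
  have "f meromorphic_on {a}"
    using f by (auto simp: form_K_def meromorphic_form_def intro: meromorphic_on_subset)
  then obtain L where L: "(\<lambda>x. f (a + x)) has_laurent_expansion L"
    unfolding meromorphic_on_def by auto
  have res: "fls_nth L (-1) = 0"
    using has_laurent_expansion_residue[OF L] f unfolding form_K_def
    by (metis fls_residue_def form_residue.simps(1))
  \<comment> \<open>\<open>c n\<close> compensates the factor \<open>- (n + 1)\<close> in \<open>e_form\<close>, and no exponent below \<open>- N\<close> occurs.\<close>
  define c where "c = (\<lambda>n. - fls_nth L (- int n - 2) / of_nat (n + 1))"
  define N where "N = nat (- fls_subdegree L)"
  let ?T = "\<lambda>n. fls_const (c n * - of_nat (n + 1)) * fls_X_intpow (- int (n + 2)) :: complex fls"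
  define P where "P = (\<Sum>n<N. ?T n)"
  have T: "?T n = fls_const (fls_nth L (- int n - 2)) * fls_X_intpow (- int n - 2)" for n
  proof -
    have "c n * - of_nat (n + 1) = fls_nth L (- int n - 2)"
      unfolding c_def by (simp del: of_nat_Suc of_nat_add)
    moreover have "- int (n + 2) = - int n - 2" by simp
    ultimately show ?thesis by (simp only:)
  qed
  have "(\<lambda>x. \<Sum>n<N. (c n * - of_nat (n + 1)) * x powi (- int (n + 2))) has_laurent_expansion P"
    unfolding P_def by (intro laurent_expansion_intros)
  also have "(\<lambda>x. \<Sum>n<N. (c n * - of_nat (n + 1)) * x powi (- int (n + 2)))
      = (\<lambda>x. polar_part c N a (a + x))"
    by (simp only: polar_part_def power_int_minus power_int_of_nat fun_eq_iff)
      (simp add: field_simps)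
  finally have q: "(\<lambda>x. f (a + x) + (-1) * polar_part c N a (a + x)) has_laurent_expansion L - P"
    using has_laurent_expansion_diff[OF L] by simp
  have "fls_nth (L - P) k = 0" if "k < 0" for k
  proof (cases "k = -1")
    case True
    have "fls_nth (?T n) (-1) = 0" for n
      unfolding T by simp
    then show ?thesis using True by (simp add: P_def fls_nth_sum res)
  next
    case False
    define m where "m = nat (- k - 2)"
    have k: "k = - int m - 2" using False that by (simp add: m_def)
    have "fls_nth (?T n) k = (if n = m then fls_nth L k else 0)" for n
      unfolding T by (simp add: k)
    then have "fls_nth P k = (if m < N then fls_nth L k else 0)"
      by (simp add: P_def fls_nth_sum)
    moreover have "fls_nth L k = 0" if "\<not> m < N"
      using that k by (intro fls_eq0_below_subdegree) (simp add: N_def)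
    ultimately show ?thesis by auto
  qed
  then have "fls_subdegree (L - P) \<ge> 0" by (rule fls_subdegree_ge0I)
  then have "\<not> is_pole (\<lambda>x. f x + (-1) * polar_part c N a x) a"
    using has_laurent_expansion_imp_is_pole_iff[OF q] by simp
  then show thesis by (rule that)
qed

text \<open>
  Liouville: the coefficient of a form regular at infinity vanishes there to second order.
\<close>

lemma form_without_poles:
  assumes f: "form_K f" and np: "\<And>z. \<not> is_pole f z"
  shows "abs_form f = 0"
proof -
  let ?F = "coeff_u (abs_form f)"
  have mero: "f meromorphic_on {z}" "f meromorphic_on UNIV" for z
    using f by (auto simp: form_K_def meromorphic_form_def intro: meromorphic_on_subset)
  have "?F analytic_on {z}" for z
  proof -
    obtain c where "f \<midarrow>z\<rightarrow> c" using not_pole_limit[OF mero(1) np] .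
    then show ?thesis
      using mero(1)[of z] f by (auto simp: coeff_u_abs meromorphic_at_iff intro: remove_sings_analytic_at)
  qed
  then have "?F holomorphic_on UNIV"
    using analytic_on_analytic_at analytic_imp_holomorphic by blast
  moreover have "(?F \<longlongrightarrow> 0) at_infinity"
  proof (rule lim_zero_infinity)
    let ?g = "inf_coeff (abs_form f)"
    have "?g analytic_on {0}"
      using inf_coeff_analytic by (rule analytic_on_subset) auto
    then have "?g \<midarrow>0\<rightarrow> ?g 0"
      by (simp add: analytic_at_imp_isCont isContD)
    then have "(\<lambda>w. - ?g w * w\<^sup>2) \<midarrow>0\<rightarrow> - ?g 0 * 0\<^sup>2"
      by (intro tendsto_intros)
    moreover have "\<forall>\<^sub>F w in at 0. - ?g w * w\<^sup>2 = ?F (1 / w)"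
      unfolding eventually_at
      by (rule exI[of _ 1]) (auto simp: inf_coeff_nonzero)
    ultimately show "((\<lambda>w. ?F (1 / w)) \<longlongrightarrow> 0) (at 0)"
      using tendsto_cong by fastforce
  qed
  ultimately have "?F z = 0" for z by (rule Liouville_weak_0)
  then have "remove_sings f z = 0" for z
    using f by (simp add: coeff_u_abs)
  then have "\<forall>\<^sub>\<approx>z. f z = 0"
    using eventually_remove_sings_eq[OF mero(2)] by (auto elim: eventually_mono)
  then have "form_eq f (\<lambda>_. 0)"
    using f form_K_zero by (simp add: form_eq_def)
  then show ?thesis
    unfolding zero_form_def by (rule Quotient3_rel_abs[OF Quotient3_form])
qed

text \<open>
  The forms \<open>e_form n a\<close> span \<open>K\<close>. Subtracting principal parts removes the finitely many poles one
  by one, and a form without poles is zero.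
\<close>

lemma form_induct [case_names e_form add scale]:
  assumes e: "\<And>n a. norm a < 1 \<Longrightarrow> P (e_form n a)"
    and add: "\<And>\<alpha> \<beta>. P \<alpha> \<Longrightarrow> P \<beta> \<Longrightarrow> P (\<alpha> + \<beta>)" and scale: "\<And>c \<alpha>. P \<alpha> \<Longrightarrow> P (c *\<^sub>C \<alpha>)"
  shows "P \<alpha>"
proof -
  have P0: "P 0"
    using scale[OF e[of 0 0], of 0] by (simp add: cscale_0_left)
  have polar: "P (abs_form (polar_part c N a))" if a: "norm a < 1" for c N a
  proof (induction N)
    case 0
    show ?case using P0 by (simp add: polar_part_def[abs_def] zero_form_def)
  next
    case (Suc N)
    have "abs_form (polar_part c (Suc N) a)
        = abs_form (polar_part c N a) + c N *\<^sub>C e_form N a"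
      unfolding e_form_def
      by (subst cscale_form.abs_eq, rule form_eq_refl[OF form_K_e_form[OF a]],
          subst plus_form.abs_eq, rule form_eq_refl[OF form_K_polar_part[OF a]],
          rule form_eq_refl[OF form_K_lmul[OF form_K_e_form[OF a]]])
        (simp add: polar_part_def[abs_def])
    then show ?case using Suc e[OF a] by (simp add: add scale)
  qed
  have "P (abs_form f)" if "form_K f" for f
    using that
  proof (induction "card {z. is_pole f z}" arbitrary: f rule: less_induct)
    case less
    show ?case
    proof (cases "\<exists>a. is_pole f a")
      case False
      then show ?thesis using form_without_poles[OF less.prems] P0 by simp
    next
      case True
      then obtain a where pole: "is_pole f a" by auto
      then have a: "norm a < 1"
        using form_K_pole_norm[OF less.prems] by blast
      obtain c N where cN: "\<not> is_pole (\<lambda>x. f x + (-1) * polar_part c N a x) a"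
        using polar_part_exists[OF less.prems a] .
      define p where "p = polar_part c N a"
      define q where "q = (\<lambda>x. f x + (-1) * p x)"
      have p: "form_K p" unfolding p_def by (rule form_K_polar_part[OF a])
      then have q: "form_K q"
        unfolding q_def by (intro form_K_add form_K_lmul less.prems)
      have mero: "f meromorphic_on {z}" "p meromorphic_on {z}" for z
        using less.prems p
        by (auto simp: form_K_def meromorphic_form_def intro: meromorphic_on_subset)
      have "is_pole f z \<and> z \<noteq> a" if "is_pole q z" for z
      proof
        show "z \<noteq> a" using that cN by (auto simp: q_def p_def)
        then have "\<not> is_pole (\<lambda>x. (-1) * p x) z"
          unfolding p_def by (intro not_pole_lmul polar_part_not_pole mero(2)[unfolded p_def])
        then show "is_pole f z"
          using that not_pole_add[of f z "\<lambda>x. (-1) * p x"] mero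
          unfolding q_def by (auto intro!: meromorphic_intros)
      qed
      then have "{z. is_pole q z} \<subset> {z. is_pole f z}"
        using pole by auto
      then have "P (abs_form q)"
        by (intro less.hyps psubset_card_mono form_K_poles_finite less.prems q)
      moreover have "abs_form f = abs_form q + abs_form p"
        using p q by (simp add: plus_form.abs_eq form_eq_refl) (simp add: q_def)
      ultimately show ?thesis
        using polar[OF a] by (simp add: add p_def)
    qed
  qed
  then show ?thesis by (metis form_obtain_rep)
qed

section \<open>The hermitian form on one-forms\<close>

text \<open>
  Re-expansion of a power series about a point of its disc of convergence, by termwise
  differentiation.
\<close>

lemma has_fps_expansion_translate:
  fixes C :: "complex fps"
  assumes a: "norm a < fps_conv_radius C"
  shows "(\<lambda>t. eval_fps C (a + t)) has_fps_expansion
    Abs_fps (\<lambda>n. suminf (\<lambda>m. fps_nth C m * of_nat (m choose n) * a ^ (m - n)))"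
proof -
  let ?D = "eball 0 (fps_conv_radius C)"
  have hd: "norm z < fps_conv_radius C \<Longrightarrow> (deriv ^^ n) (eval_fps C) z = eval_fps (fps_nth_deriv n C) z
      \<and> fps_conv_radius (fps_nth_deriv n C) \<ge> fps_conv_radius C" for n z
  proof (induction n arbitrary: z)
    case (Suc n)
    have "\<forall>\<^sub>F w in nhds z. w \<in> ?D"
      using Suc.prems by (intro eventually_nhds_in_open) auto
    then have "\<forall>\<^sub>F w in nhds z. (deriv ^^ n) (eval_fps C) w = eval_fps (fps_nth_deriv n C) w"
      by eventually_elim (use Suc.IH in auto)
    then have "deriv ((deriv ^^ n) (eval_fps C)) z = deriv (eval_fps (fps_nth_deriv n C)) z"
      by (rule deriv_cong_ev) simp
    then show ?case
      using Suc.IH[OF Suc.prems] Suc.prems fps_conv_radius_deriv[of "fps_nth_deriv n C"]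
      by (auto simp: fps_nth_deriv_commute eval_fps_deriv simp del: fps_nth_deriv.simps(2)
          intro: order_trans)
  qed auto
  have nth: "fps_nth (fps_nth_deriv n C) m = fact n * of_nat ((m + n) choose n) * fps_nth C (m + n)" for n m
  proof (induction n arbitrary: m)
    case (Suc n)
    have "of_nat (Suc m) * of_nat ((Suc m + n) choose n) = of_nat (Suc n) * (of_nat ((m + Suc n) choose Suc n) :: complex)"
    proof -
      have "Suc m * ((Suc m + n) choose n) = Suc n * ((m + Suc n) choose Suc n)"
        using binomial_absorb_comp[of "m + Suc n" n] binomial_absorption[of n "m + Suc n"]
        by (simp add: mult.commute)
      then show ?thesis by (metis of_nat_mult)
    qed
    then show ?case
      by (simp add: fps_nth_deriv_commute Suc algebra_simps del: fps_nth_deriv.simps(2) of_nat_Suc binomial_Suc_Suc)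
  qed auto
  have an: "eval_fps C analytic_on {a}"
    using a by (intro analytic_on_eval_fps) auto
  have "fps_expansion (eval_fps C) a
      = Abs_fps (\<lambda>n. suminf (\<lambda>m. fps_nth C m * of_nat (m choose n) * a ^ (m - n)))"
  proof (rule fps_ext)
    fix n
    let ?t = "\<lambda>m. fps_nth C m * of_nat (m choose n) * a ^ (m - n)"
    have "(\<lambda>m. fps_nth (fps_nth_deriv n C) m * a ^ m) sums eval_fps (fps_nth_deriv n C) a"
      using hd[OF a, of n] a by (intro sums_eval_fps) auto
    then have "(\<lambda>m. fps_nth (fps_nth_deriv n C) m * a ^ m / fact n) sums
        (eval_fps (fps_nth_deriv n C) a / fact n)"
      by (rule sums_divide)
    then have "(\<lambda>m. ?t (m + n)) sums (eval_fps (fps_nth_deriv n C) a / fact n)"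
      by (simp add: nth mult_ac)
    then have "?t sums (eval_fps (fps_nth_deriv n C) a / fact n)"
      by (subst (asm) sums_zero_iff_shift) auto
    then show "fps_nth (fps_expansion (eval_fps C) a) n = fps_nth (Abs_fps (\<lambda>n. suminf (\<lambda>m. fps_nth C m * of_nat (m choose n) * a ^ (m - n)))) n"
      using hd[OF a, of n] by (simp add: fps_expansion_def sums_iff)
  qed
  then show ?thesis
    using analytic_at_imp_has_fps_expansion[OF an] by simp
qed

definition inf_fps :: "form \<Rightarrow> complex fps"
  where "inf_fps \<alpha> = fps_expansion (inf_coeff \<alpha>) 0"

text \<open>
  Analyticity on the closed disc gives a radius of convergence strictly greater than one. This makes
  the coefficients absolutely summable, on which the convergence of the pairing below rests.
\<close>

lemma inf_fps_radius: "fps_conv_radius (inf_fps \<alpha>) > 1"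
  and eval_inf_fps: "norm w \<le> 1 \<Longrightarrow> eval_fps (inf_fps \<alpha>) w = inf_coeff \<alpha> w"
proof -
  obtain T where T: "open T" "cball 0 1 \<subseteq> T" "inf_coeff \<alpha> holomorphic_on T"
    using inf_coeff_analytic[of \<alpha>] unfolding analytic_on_holomorphic by auto
  obtain e where e: "e > 0" "(\<Union>x\<in>cball 0 1. ball x e) \<subseteq> T"
    using compact_subset_open_imp_ball_epsilon_subset[OF compact_cball T(1,2)] .
  \<comment> \<open>The point of the unit disc nearest to an outer point \<open>z\<close> is \<open>sgn z\<close>.\<close>
  have "ball 0 (1 + e) \<subseteq> (\<Union>x\<in>cball (0::complex) 1. ball x e)"
  proof
    fix z :: complex assume z: "z \<in> ball 0 (1 + e)"
    show "z \<in> (\<Union>x\<in>cball 0 1. ball x e)"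
    proof (cases "norm z \<le> 1")
      case True then show ?thesis using e by (intro UN_I[of z]) auto
    next
      case False
      have "z - sgn z = (1 - 1 / norm z) *\<^sub>R z"
        by (simp add: sgn_div_norm algebra_simps divide_inverse)
      then have "norm (z - sgn z) = \<bar>1 - 1 / norm z\<bar> * norm z"
        by (simp only: norm_scaleR)
      also have "\<dots> = norm z - 1"
      proof -
        have "1 - 1 / norm z \<ge> 0" using False by (simp add: divide_le_eq)
        then show ?thesis using False by (cases "z = 0") (auto simp add: abs_of_nonneg left_diff_distrib)
      qed
      finally have "norm (z - sgn z) = norm z - 1" .
      then show ?thesis using z False
        by (intro UN_I[of "sgn z"]) (auto simp: dist_norm norm_minus_commute norm_sgn)
    qed
  qed
  then have hol: "inf_coeff \<alpha> holomorphic_on eball 0 (ereal (1 + e))"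
    using T(3) e(2) by (auto intro: holomorphic_on_subset)
  have "ereal 1 < ereal (1 + e)" using e by simp
  also have "\<dots> \<le> fps_conv_radius (inf_fps \<alpha>)"
    unfolding inf_fps_def by (rule conv_radius_fps_expansion[OF hol])
  finally show "fps_conv_radius (inf_fps \<alpha>) > 1" by (simp add: one_ereal_def)
  show "eval_fps (inf_fps \<alpha>) w = inf_coeff \<alpha> w" if "norm w \<le> 1"
    using eval_fps_expansion'[OF hol, of w] that e unfolding inf_fps_def by simp
qed

lemma inf_coeff_has_fps_expansion: "inf_coeff \<alpha> has_fps_expansion inf_fps \<alpha>"
  unfolding inf_fps_def
  by (rule analytic_at_imp_has_fps_expansion_0, rule analytic_on_subset[OF inf_coeff_analytic]) auto

lemma inf_fps_eqI:
  assumes "\<And>w. norm w < 1 \<Longrightarrow> inf_coeff \<alpha> w = g w" "g has_fps_expansion G"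
  shows "inf_fps \<alpha> = G"
proof -
  have "\<forall>\<^sub>F w in nhds (0::complex). w \<in> ball 0 1"
    by (intro eventually_nhds_in_open) auto
  then have "\<forall>\<^sub>F w in nhds 0. inf_coeff \<alpha> w = g w"
    by eventually_elim (use assms(1) in auto)
  then have "inf_coeff \<alpha> has_fps_expansion G"
    using has_fps_expansion_cong[OF _ refl] assms(2) by metis
  then show ?thesis
    using fps_expansion_unique_complex inf_coeff_has_fps_expansion by blast
qed

lemma inf_fps_add: "inf_fps (\<alpha> + \<beta>) = inf_fps \<alpha> + inf_fps \<beta>"
  by (rule inf_fps_eqI[OF _ has_fps_expansion_add[OF inf_coeff_has_fps_expansion inf_coeff_has_fps_expansion]])
    (simp add: inf_coeff_add)

lemma inf_fps_scale: "inf_fps (c *\<^sub>C \<alpha>) = fps_const c * inf_fps \<alpha>"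
  by (rule inf_fps_eqI[OF _ has_fps_expansion_cmult_left[OF inf_coeff_has_fps_expansion]])
    (simp add: inf_coeff_scale)

text \<open>
  The expansion of \<open>(n + 1) w\<^sup>n (1 - a w)\<^bsup>-(n + 2)\<^esup>\<close> by the negative binomial series.
\<close>

lemma inf_fps_e_form:
  assumes "norm a < 1"
  shows "fps_nth (inf_fps (e_form n a)) m = of_nat (m + 1) * of_nat (m choose n) * a ^ (m - n)"
proof -
  let ?B = "(1 - fps_const a * fps_X) ^ (n + 2)"
  have "inf_fps (e_form n a) = fps_const (of_nat (n + 1)) * (fps_X ^ n * inverse ?B)"
  proof (rule inf_fps_eqI)
    show "inf_coeff (e_form n a) w = of_nat (n + 1) * (w ^ n * inverse ((1 - a * w) ^ (n + 2)))"
      if "norm w < 1" for w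
      using inf_coeff_e_form[OF assms, of w n] that by (simp add: divide_inverse)
    have "fps_nth ?B 0 \<noteq> 0" by (simp add: fps_power_zeroth)
    then show "(\<lambda>w. of_nat (n + 1) * (w ^ n * inverse ((1 - a * w) ^ (n + 2)))) has_fps_expansion
        fps_const (of_nat (n + 1)) * (fps_X ^ n * inverse ?B)"
      by (intro fps_expansion_intros)
  qed
  then have "fps_nth (inf_fps (e_form n a)) m =
      of_nat (n + 1) * (if m < n then 0 else of_nat ((n + 2 + (m - n) - 1) choose (m - n)) * a ^ (m - n))"
    by (simp only: one_minus_const_fps_X_neg_power' fps_mult_left_const_nth fps_X_power_mult_nth)
      (simp add: one_minus_const_fps_X_neg_power')
  also have "\<dots> = of_nat (m + 1) * of_nat (m choose n) * a ^ (m - n)"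
  proof (cases "m < n")
    case False
    then have "n + 2 + (m - n) - 1 = Suc m" by simp
    moreover have "Suc m choose (m - n) = Suc m choose Suc n"
      using False binomial_symmetric[of "Suc n" "Suc m"] by simp
    moreover have "Suc n * (Suc m choose Suc n) = Suc m * (m choose n)"
      using Suc_times_binomial_eq[of m n] by (simp only: mult.commute)
    then have "of_nat (n + 1) * of_nat (Suc m choose Suc n) = (of_nat (m + 1) * of_nat (m choose n) :: complex)"
      by (metis Suc_eq_plus1 of_nat_mult)
    ultimately show ?thesis using False by (simp only: if_False mult.assoc[symmetric])
  qed (simp add: binomial_eq_0)
  finally show ?thesis .
qed

text \<open>
  Up to the factor \<open>\<pi>\<close> this is the Bergman inner product of the chart coefficients on \<open>|w| < 1\<close>.
  The weight cancels the factor \<open>m + 1\<close> in the coefficients of \<open>e_form n a\<close>, so that pairing with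
  \<open>e_form 0 a\<close> is evaluation at the conjugate of \<open>a\<close>, as the adjointness conditions demand.
\<close>

definition form_pairing :: "form \<Rightarrow> form \<Rightarrow> complex"
  where "form_pairing \<alpha> \<beta> =
    suminf (\<lambda>m. cnj (fps_nth (inf_fps \<alpha>) m) * fps_nth (inf_fps \<beta>) m / of_nat (m + 1))"

lemma summable_form_pairing:
  "summable (\<lambda>m. cnj (fps_nth (inf_fps \<alpha>) m) * fps_nth (inf_fps \<beta>) m / of_nat (m + 1))"
proof -
  have s: "summable (\<lambda>m. norm (fps_nth (inf_fps \<gamma>) m))" for \<gamma>
    using norm_summable_fps[of 1 "inf_fps \<gamma>"] inf_fps_radius[of \<gamma>] by (simp add: one_ereal_def)
  have "Bseq (\<lambda>m. norm (fps_nth (inf_fps \<beta>) m))"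
    using s[of \<beta>] by (metis convergentI convergent_imp_Bseq summable_LIMSEQ_zero)
  then obtain K where K: "K > 0" "\<And>m. norm (fps_nth (inf_fps \<beta>) m) \<le> K"
    by (auto elim!: BseqE)
  show ?thesis
  proof (rule summable_comparison_test'[of _ 0])
    show "summable (\<lambda>m. norm (fps_nth (inf_fps \<alpha>) m) * K)"
      by (intro summable_mult2 s)
    fix m
    have "norm (fps_nth (inf_fps \<alpha>) m) * norm (fps_nth (inf_fps \<beta>) m) / real (m + 1)
        \<le> norm (fps_nth (inf_fps \<alpha>) m) * K / 1"
      using K by (intro frac_le mult_left_mono mult_nonneg_nonneg) auto
    then show "norm (cnj (fps_nth (inf_fps \<alpha>) m) * fps_nth (inf_fps \<beta>) m / of_nat (m + 1))
        \<le> norm (fps_nth (inf_fps \<alpha>) m) * K"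
      by (simp only: norm_mult norm_divide complex_mod_cnj norm_of_nat div_by_1)
  qed
qed

lemma form_pairing_hermitian: "form_pairing \<beta> \<alpha> = cnj (form_pairing \<alpha> \<beta>)"
proof -
  have "cnj (form_pairing \<alpha> \<beta>)
      = suminf (\<lambda>m. cnj (cnj (fps_nth (inf_fps \<alpha>) m) * fps_nth (inf_fps \<beta>) m / of_nat (m + 1)))"
    unfolding form_pairing_def
    by (intro sums_unique) (subst sums_cnj, rule summable_sums[OF summable_form_pairing])
  then show ?thesis
    by (simp add: form_pairing_def mult.commute)
qed

lemma form_pairing_add: "form_pairing \<alpha> (\<beta> + \<gamma>) = form_pairing \<alpha> \<beta> + form_pairing \<alpha> \<gamma>"
  unfolding form_pairing_def
  by (subst suminf_add[OF summable_form_pairing summable_form_pairing])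
    (simp add: inf_fps_add algebra_simps add_divide_distrib)

lemma form_pairing_scale: "form_pairing \<alpha> (c *\<^sub>C \<beta>) = c * form_pairing \<alpha> \<beta>"
  unfolding form_pairing_def
  by (subst suminf_mult[OF summable_form_pairing, symmetric]) (simp add: inf_fps_scale mult_ac)

interpretation form_space: hermitian_space form_pairing
proof (rule hermitian_space.intro)
  show "clinear (form_pairing \<alpha>)" for \<alpha>
    by (rule clinearI) (simp_all add: form_pairing_add form_pairing_scale cscale_complex_def)
  show "form_pairing \<beta> \<alpha> = cnj (form_pairing \<alpha> \<beta>)" for \<alpha> \<beta>
    by (rule form_pairing_hermitian)
qed

lemma form_pairing_e_form:
  assumes "norm a < 1"
  shows "form_pairing \<alpha> (e_form n a)
    = suminf (\<lambda>m. cnj (fps_nth (inf_fps \<alpha>) m) * of_nat (m choose n) * a ^ (m - n))"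
proof -
  have "of_nat (m + 1) \<noteq> (0::complex)" for m
    by (metis of_nat_0_neq Suc_eq_plus1)
  then show ?thesis
    unfolding form_pairing_def inf_fps_e_form[OF assms]
    by (intro suminf_cong) (simp add: field_simps)
qed

text \<open>The expansion of the function \<open>a \<mapsto> cnj (inf_coeff \<alpha> (cnj a))\<close>.\<close>

definition inf_fps_cnj :: "form \<Rightarrow> complex fps"
  where "inf_fps_cnj \<alpha> = Abs_fps (\<lambda>m. cnj (fps_nth (inf_fps \<alpha>) m))"

lemma inf_fps_cnj_radius: "fps_conv_radius (inf_fps_cnj \<alpha>) > 1"
proof -
  have "fps_conv_radius (inf_fps_cnj \<alpha>) = fps_conv_radius (inf_fps \<alpha>)"
    unfolding fps_conv_radius_def inf_fps_cnj_def
    by (subst (1 2) conv_radius_norm[symmetric]) simp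
  then show ?thesis using inf_fps_radius by simp
qed

lemma form_pairing_e_form_0:
  assumes "norm a < 1"
  shows "form_pairing \<alpha> (e_form 0 a) = eval_fps (inf_fps_cnj \<alpha>) a"
    and form_pairing_e_form_inf_coeff: "form_pairing \<alpha> (e_form 0 a) = cnj (inf_coeff \<alpha> (cnj a))"
proof -
  show 1: "form_pairing \<alpha> (e_form 0 a) = eval_fps (inf_fps_cnj \<alpha>) a"
    by (simp add: form_pairing_e_form assms eval_fps_def inf_fps_cnj_def)
  have "norm (cnj a) < fps_conv_radius (inf_fps \<alpha>)"
    using assms inf_fps_radius[of \<alpha>] by (metis complex_mod_cnj ereal_less(2) less_trans one_ereal_def ereal_less_eq(3) ereal_less)
  then have "(\<lambda>m. cnj (fps_nth (inf_fps \<alpha>) m * cnj a ^ m)) sums cnj (eval_fps (inf_fps \<alpha>) (cnj a))"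
    by (subst sums_cnj) (rule sums_eval_fps)
  then show "form_pairing \<alpha> (e_form 0 a) = cnj (inf_coeff \<alpha> (cnj a))"
    using assms by (simp add: 1 eval_fps_def inf_fps_cnj_def sums_iff eval_inf_fps[symmetric])
qed

text \<open>
  Pairing with \<open>e_form n a\<close> yields exactly the coefficients that re-expansion at \<open>a\<close> produces.
  This is the case of one-forms of \<open>pairs_e_sections\<close>.
\<close>

lemma form_pairing_has_fps_expansion:
  assumes a: "norm a < 1"
  shows "(\<lambda>t. form_pairing \<alpha> (e_form 0 (a + t))) has_fps_expansion
    Abs_fps (\<lambda>n. form_pairing \<alpha> (e_form n a))"
proof -
  have "norm a < fps_conv_radius (inf_fps_cnj \<alpha>)"
    using a inf_fps_cnj_radius[of \<alpha>] by (metis less_trans one_ereal_def ereal_less(3) less_ereal.simps(1))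
  from has_fps_expansion_translate[OF this]
  have *: "(\<lambda>t. eval_fps (inf_fps_cnj \<alpha>) (a + t)) has_fps_expansion
      Abs_fps (\<lambda>n. form_pairing \<alpha> (e_form n a))"
    by (simp add: form_pairing_e_form a inf_fps_cnj_def)
  have "\<forall>\<^sub>F t in nhds (0::complex). t \<in> ball 0 (1 - norm a)"
    using a by (intro eventually_nhds_in_open) auto
  then have "\<forall>\<^sub>F t in nhds 0. form_pairing \<alpha> (e_form 0 (a + t)) = eval_fps (inf_fps_cnj \<alpha>) (a + t)"
  proof eventually_elim
    case (elim t)
    then have "norm (a + t) < 1" using norm_triangle_ineq[of a t] by simp
    then show ?case by (rule form_pairing_e_form_0)
  qed
  then show ?thesis
    using has_fps_expansion_cong[OF _ refl] * by metis
qed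

section \<open>The operators \<open>i(z)\<close> as contractions\<close>

text \<open>
  In terms of \<open>eval_contract\<close> the frames \<open>du\<close> and \<open>d(1/u)\<close> need no separate treatment: the factors
  \<open>1/a\<^sup>2\<close> and \<open>-1\<close> by which \<open>i_op\<close> differs from it compensate those of \<open>circle_pullback\<close>.
\<close>

definition eval_contract :: "complex \<Rightarrow> fock \<Rightarrow> fock"
  where "eval_contract w = contract (\<lambda>\<alpha>. inf_coeff \<alpha> w)"

lemma derivation_contract: "clinear l \<Longrightarrow> derivation (contract l)"
  by (simp add: derivation_def clinear_contract contract_times)

lemma i_op_eq_contract:
  assumes "clinear l" "\<And>\<alpha>. - form_at \<alpha> p = l \<alpha>"
  shows "i_op p = contract l"
  unfolding i_op_def
proof (rule the_equality)
  show "derivation (contract l) \<and> contract l 1 = 0 \<and>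
      (\<forall>\<alpha>. contract l (sym_of \<alpha>) = (- form_at \<alpha> p) *\<^sub>C 1)"
    using contract_gen[OF assms(1), of _ 1]
    by (simp add: derivation_contract contract_one assms)
  show "d = contract l" if "derivation d \<and> d 1 = 0 \<and>
      (\<forall>\<alpha>. d (sym_of \<alpha>) = (- form_at \<alpha> p) *\<^sub>C 1)" for d
    using that assms unfolding derivation_def by (intro derivation_eqI) auto
qed

lemma i_op_Aff:
  assumes "norm a \<ge> 1"
  shows "i_op (Aff a) \<psi> = (1 / a\<^sup>2) *\<^sub>C eval_contract (1 / a) \<psi>"
proof -
  have "norm (1 / a) \<le> 1" using assms by (simp add: norm_divide divide_le_eq)
  note lin = clinear_inf_coeff[OF this]
  from clinear_scaled[OF lin] have "i_op (Aff a) = contract (\<lambda>\<alpha>. (1 / a\<^sup>2) * inf_coeff \<alpha> (1 / a))"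
    by (rule i_op_eq_contract) (simp add: coeff_u_inf_coeff assms)
  then show ?thesis
    by (simp only: eval_contract_def contract_scale_functional[OF lin])
qed

lemma i_op_Infty: "i_op Infty \<psi> = (-1) *\<^sub>C eval_contract 0 \<psi>"
proof -
  have lin: "clinear (\<lambda>\<alpha>. inf_coeff \<alpha> 0)" by (rule clinear_inf_coeff) simp
  from clinear_scaled[OF lin] have "i_op Infty = contract (\<lambda>\<alpha>. (-1) * inf_coeff \<alpha> 0)"
    by (rule i_op_eq_contract) (simp add: inf_coeff_def)
  then show ?thesis
    by (simp only: eval_contract_def contract_scale_functional[OF lin])
qed

text \<open>
  Stated for all functionals, because the product rule leads from \<open>l\<close> to the functional
  \<open>x \<mapsto> l (v x)\<close>.
\<close>

lemma eval_contract_holomorphic: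
  "clinear l \<Longrightarrow> (\<lambda>w. l (eval_contract w \<psi>)) holomorphic_on ball 0 1"
proof (induction \<psi> arbitrary: l rule: symalg_induct)
  case one
  have "l (eval_contract w 1) = 0" if "w \<in> ball 0 1" for w
    using that by (simp add: eval_contract_def contract_one clinear_inf_coeff clinear_0[OF one])
  then show ?case by (subst holomorphic_cong[OF refl]) auto
next
  case (gen v \<psi>)
  have "clinear (\<lambda>x. l (sym_of v * x))"
    by (rule clinearI) (simp_all add: distrib_left cscale_times_right clinear_add[OF gen.prems]
      clinear_scale[OF gen.prems])
  then have "(\<lambda>w. l (sym_of v * eval_contract w \<psi>)) holomorphic_on ball 0 1"
    by (rule gen.IH)
  moreover have "inf_coeff v holomorphic_on ball 0 1"
    by (intro analytic_imp_holomorphic analytic_on_subset[OF inf_coeff_analytic]) auto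
  ultimately have "(\<lambda>w. inf_coeff v w * l \<psi> + l (sym_of v * eval_contract w \<psi>)) holomorphic_on ball 0 1"
    by (intro holomorphic_intros)
  moreover have "l (eval_contract w (sym_of v * \<psi>))
      = inf_coeff v w * l \<psi> + l (sym_of v * eval_contract w \<psi>)" if "w \<in> ball 0 1" for w
    using that by (simp add: eval_contract_def contract_gen clinear_inf_coeff
        clinear_add[OF gen.prems] clinear_scale[OF gen.prems])
      (simp add: cscale_complex_def)
  ultimately show ?case by (subst holomorphic_cong[OF refl]) auto
next
  case (add x y)
  have "l (eval_contract w (x + y)) = l (eval_contract w x) + l (eval_contract w y)"
    if "w \<in> ball 0 1" for w
    using that by (simp add: eval_contract_def contract_add clinear_inf_coeff clinear_add[OF add.prems])
  then show ?case
    using holomorphic_on_add[OF add.IH[OF add.prems]] by (subst holomorphic_cong[OF refl]) auto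
next
  case (scale c x)
  have "l (eval_contract w (c *\<^sub>C x)) = c * l (eval_contract w x)" if "w \<in> ball 0 1" for w
    using that by (simp add: eval_contract_def contract_scale clinear_inf_coeff
        clinear_scale[OF scale.prems]) (simp add: cscale_complex_def)
  then show ?case
    using holomorphic_on_mult[OF holomorphic_on_const scale.IH[OF scale.prems]]
    by (subst holomorphic_cong[OF refl]) auto
qed

section \<open>The adjointness conditions\<close>

lemma Aff_in_disc: "Aff a \<in> disc \<longleftrightarrow> norm a < 1"
  and Infty_notin_disc: "Infty \<notin> disc"
  by (auto simp: disc_def)

lemma Infty_in_disc': "Infty \<in> disc'"
  unfolding disc'_def by (rule image_eqI[of _ _ "Aff 0"]) (auto simp: disc_def)

lemma Aff_in_disc': "Aff a \<in> disc' \<longleftrightarrow> norm a > 1"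
proof
  assume "Aff a \<in> disc'"
  then obtain b where "norm b < 1" "circle_refl (Aff b) = Aff a"
    by (auto simp: disc'_def disc_def)
  then have "b \<noteq> 0" "a = 1 / cnj b" by (auto split: if_splits)
  then show "norm a > 1" using \<open>norm b < 1\<close> by (simp add: norm_divide)
next
  assume a: "norm a > 1"
  then have "a \<noteq> 0" by auto
  with a have "norm (1 / cnj a) < 1" by (simp add: norm_divide divide_less_eq)
  then show "Aff a \<in> disc'"
    unfolding disc'_def using \<open>a \<noteq> 0\<close>
    by (intro image_eqI[of _ _ "Aff (1 / cnj a)"]) (auto simp: disc_def)
qed

lemma meromorphic_section_disc'_cong:
  assumes "\<And>z. z \<in> disc' \<Longrightarrow> s z = t z"
  shows "meromorphic_section disc' s \<longleftrightarrow> meromorphic_section disc' t"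
proof -
  have "\<forall>\<^sub>F b in at a. s (Aff b) = t (Aff b)" if "norm a > 1" for a
  proof -
    have "open (norm -` {1<..} :: complex set)"
      by (intro open_vimage continuous_intros open_greaterThan)
    then have "\<forall>\<^sub>F b in at a. b \<in> norm -` {1<..}"
      using that by (intro eventually_at_in_open') auto
    then show ?thesis
      by eventually_elim (simp add: assms Aff_in_disc')
  qed
  then have 1: "(\<lambda>a. s (Aff a)) meromorphic_on {a. Aff a \<in> disc'}
      \<longleftrightarrow> (\<lambda>a. t (Aff a)) meromorphic_on {a. Aff a \<in> disc'}"
    by (intro meromorphic_on_cong) (auto simp: Aff_in_disc')
  have "chart_inf (\<lambda>a. s (Aff a)) w = chart_inf (\<lambda>a. t (Aff a)) w" if "w \<noteq> 0" "norm w < 1" for w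
    using that assms[of "Aff (1 / w)"] by (simp add: chart_inf_def Aff_in_disc' norm_divide)
  then have "\<forall>\<^sub>F w in at 0. chart_inf (\<lambda>a. s (Aff a)) w = chart_inf (\<lambda>a. t (Aff a)) w"
    unfolding eventually_at by (intro exI[of _ 1]) auto
  then have "chart_inf (\<lambda>a. s (Aff a)) meromorphic_on {0}
      \<longleftrightarrow> chart_inf (\<lambda>a. t (Aff a)) meromorphic_on {0}"
    by (intro meromorphic_on_cong) auto
  with 1 show ?thesis by (simp add: meromorphic_section_def)
qed

text \<open>
  For a hermitian structure that pairs sections, all four conditions reduce to the single equation
  \<open>h \<phi> (e\<^sub>a \<psi>) = h (J(cnj a) \<phi>) \<psi>\<close>, where \<open>J\<close> is \<open>eval_contract\<close>: adjointness of creation by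
  \<open>e\<^sub>a\<close> and contraction at the reflected point. Meromorphy of the sections follows, as the left hand side
  has Taylor expansions in \<open>a\<close> and \<open>J(w)\<close> depends holomorphically on \<open>w\<close>.
\<close>

locale hermitian_pairing =
  fixes h :: "fock \<Rightarrow> fock \<Rightarrow> complex"
  assumes hermitian: "hermitian_structure h" and pairs: "pairs_e_sections h"
begin

lemma add_right: "h \<phi> (\<psi> + \<psi>') = h \<phi> \<psi> + h \<phi> \<psi>'"
  and scale_right: "h \<phi> (c *\<^sub>C \<psi>) = c * h \<phi> \<psi>"
  and add_left: "h (\<phi> + \<phi>') \<psi> = h \<phi> \<psi> + h \<phi>' \<psi>"
  and scale_left: "h (c *\<^sub>C \<phi>) \<psi> = cnj c * h \<phi> \<psi>"
  using hermitian unfolding hermitian_structure_def by blast+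

lemma swap: "h \<psi> \<phi> = cnj (h \<phi> \<psi>)"
  using hermitian unfolding hermitian_structure_def by blast

lemma zero_left: "h 0 \<psi> = 0"
  using add_left[of 0 0 \<psi>] by simp

lemma clinear_right: "clinear (h \<phi>)"
  by (rule clinearI) (simp_all add: add_right scale_right cscale_complex_def)

lemma e_holomorphic: "(\<lambda>a. h \<phi> (e_coeff 0 a \<psi>)) holomorphic_on ball 0 1"
proof -
  have "(\<lambda>a. h \<phi> (e_coeff 0 a \<psi>)) analytic_on {a}" if "norm a < 1" for a
    using pairs that unfolding pairs_e_sections_def by (blast intro: has_fps_expansion_imp_analytic)
  then have "(\<lambda>a. h \<phi> (e_coeff 0 a \<psi>)) analytic_on ball 0 1"
    by (subst analytic_on_analytic_at) auto
  then show ?thesis by (rule analytic_imp_holomorphic)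
qed

text \<open>
  The right hand side has this one shape at all points of the disc, including \<open>a = 0\<close>, whose
  reflection is the pole of \<open>u\<close>.
\<close>

lemma cond_e_rhs:
  assumes "norm a < 1"
  shows "- circle_pullback (Aff a) (h (i_op (circle_refl (Aff a)) \<phi>) \<psi>)
    = h (eval_contract (cnj a) \<phi>) \<psi>"
proof (cases "a = 0")
  case True
  then show ?thesis by (simp add: i_op_Infty scale_left)
next
  case False
  then have "norm (1 / cnj a) \<ge> 1" using assms by (simp add: norm_divide)
  with False show ?thesis
    by (simp add: i_op_Aff scale_left power_divide)
qed

lemma cond_e_iff:
  "cond_e h \<phi> \<psi> \<longleftrightarrow> (\<forall>a. norm a < 1 \<longrightarrow> h \<phi> (e_coeff 0 a \<psi>) = h (eval_contract (cnj a) \<phi>) \<psi>)"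
proof
  assume "cond_e h \<phi> \<psi>"
  then show "\<forall>a. norm a < 1 \<longrightarrow> h \<phi> (e_coeff 0 a \<psi>) = h (eval_contract (cnj a) \<phi>) \<psi>"
    unfolding cond_e_def section_eq_def
    by (metis Aff_in_disc cond_e_rhs e_op.simps(1))
next
  assume eq: "\<forall>a. norm a < 1 \<longrightarrow> h \<phi> (e_coeff 0 a \<psi>) = h (eval_contract (cnj a) \<phi>) \<psi>"
  have D: "{a. Aff a \<in> disc} = ball 0 1" by (auto simp: Aff_in_disc)
  have m: "(\<lambda>a. h \<phi> (e_coeff 0 a \<psi>)) meromorphic_on ball 0 1"
    using e_holomorphic by (simp add: analytic_on_imp_meromorphic_on analytic_on_open)
  have "\<forall>\<^sub>F b in at a. - circle_pullback (Aff b) (h (i_op (circle_refl (Aff b)) \<phi>) \<psi>)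
      = h \<phi> (e_coeff 0 b \<psi>)" if "a \<in> ball 0 1" for a
  proof -
    have "\<forall>\<^sub>F b in at a. b \<in> ball 0 1"
      using that by (intro eventually_at_in_open') auto
    then show ?thesis
      by eventually_elim (use eq cond_e_rhs in auto)
  qed
  then have "(\<lambda>a. - circle_pullback (Aff a) (h (i_op (circle_refl (Aff a)) \<phi>) \<psi>)) meromorphic_on ball 0 1"
    by (rule iffD2[OF meromorphic_on_cong[OF _ refl] m])
  then show "cond_e h \<phi> \<psi>"
    unfolding cond_e_def section_eq_def meromorphic_section_def D
    using m eq cond_e_rhs Infty_notin_disc by (auto simp: disc_def simp del: circle_pullback.simps circle_refl.simps)
qed

lemma cond_e_hat_iff:
  "cond_e_hat h \<phi> \<psi> \<longleftrightarrow>
    (\<forall>a. norm a < 1 \<and> a \<noteq> 0 \<longrightarrow> h \<phi> (e_coeff 0 a \<psi>) = h (eval_contract (cnj a) \<phi>) \<psi>)"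
proof -
  have "a\<^sup>2 * h \<phi> (e_op (Aff a) \<psi>) = h (i_op (circle_refl (Aff a)) \<phi>) \<psi> \<longleftrightarrow>
      h \<phi> (e_coeff 0 a \<psi>) = h (eval_contract (cnj a) \<phi>) \<psi>" if "norm a < 1" "a \<noteq> 0" for a
    unfolding cond_e_rhs[OF that(1), symmetric] using that(2) by (auto simp: field_simps)
  then show ?thesis
    unfolding cond_e_hat_def Aff_in_disc by blast
qed

text \<open>
  The condition with hats lacks only the point \<open>a = 0\<close>, where both sides are continuous. For the
  right hand side this is seen after exchanging the arguments of \<open>h\<close>, since it is antiholomorphic
  in the point of evaluation.
\<close>

lemma cond_e_iff_hat: "cond_e h \<phi> \<psi> \<longleftrightarrow> cond_e_hat h \<phi> \<psi>"
proof -
  let ?f = "\<lambda>a. h \<phi> (e_coeff 0 a \<psi>)" and ?g = "\<lambda>w. h \<psi> (eval_contract w \<phi>)"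
  have cont: "isCont f 0" if "f holomorphic_on ball 0 1" for f :: "complex \<Rightarrow> complex"
    using that by (metis centre_in_ball continuous_on_eq_continuous_at holomorphic_on_imp_continuous_on
        open_ball zero_less_one)
  have f: "?f \<midarrow>0\<rightarrow> ?f 0"
    using cont[OF e_holomorphic] by (rule isContD)
  have "isCont (\<lambda>a. cnj (?g (cnj a))) 0"
    using cont[OF eval_contract_holomorphic[OF clinear_right]]
    by (intro continuous_intros isCont_o2[of _ cnj ?g]) auto
  then have g: "(\<lambda>a. cnj (?g (cnj a))) \<midarrow>0\<rightarrow> cnj (?g (cnj 0))"
    by (rule isContD)
  have "?f 0 = cnj (?g (cnj 0))" if "cond_e_hat h \<phi> \<psi>"
  proof -
    have "?f a = cnj (?g (cnj a))" if "a \<noteq> 0" "norm a < 1" for a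
      using that \<open>cond_e_hat h \<phi> \<psi>\<close> swap unfolding cond_e_hat_iff by metis
    then have "\<forall>\<^sub>F a in at 0. ?f a = cnj (?g (cnj a))"
      unfolding eventually_at by (intro exI[of _ 1]) auto
    then have "?f \<midarrow>0\<rightarrow> cnj (?g (cnj 0))"
      using g tendsto_cong by fast
    then show ?thesis using f LIM_unique by blast
  qed
  then show ?thesis
    unfolding cond_e_iff cond_e_hat_iff using swap by (metis complex_cnj_zero)
qed

text \<open>
  Condition (ii) is the complex conjugate of condition (i) with the two arguments exchanged. The
  points of \<open>D'\<close> are parametrised by the points \<open>a\<close> of \<open>D\<close> of which they are reflections.
\<close>

lemma cond_i_iff: "cond_i h \<phi> \<psi> \<longleftrightarrow> cond_e h \<psi> \<phi>"
  and cond_i_hat_iff: "cond_i_hat h \<phi> \<psi> \<longleftrightarrow> cond_e_hat h \<psi> \<phi>"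
proof -
  define s where "s = (\<lambda>z. h \<phi> (i_op z \<psi>))"
  define t where "t = (\<lambda>z. - circle_pullback z (h (e_op (circle_refl z) \<phi>) \<psi>))"
  define adj where "adj a \<longleftrightarrow> h \<psi> (e_coeff 0 a \<phi>) = h (eval_contract (cnj a) \<psi>) \<phi>" for a
  have adj: "adj a \<longleftrightarrow> h \<phi> (eval_contract (cnj a) \<psi>) = h (e_coeff 0 a \<phi>) \<psi>" for a
    unfolding adj_def by (metis swap)
  have sI: "s Infty = - h \<phi> (eval_contract 0 \<psi>)"
    by (simp add: s_def i_op_Infty scale_right)
  have sA: "s (Aff b) = h \<phi> (eval_contract (1 / b) \<psi>) / b\<^sup>2" if "norm b > 1" for b
    using that by (simp add: s_def i_op_Aff scale_right)
  have I: "s Infty = t Infty \<longleftrightarrow> adj 0"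
    unfolding adj by (simp add: sI t_def)
  have A: "s (Aff (1 / cnj a)) = t (Aff (1 / cnj a)) \<longleftrightarrow> adj a"
    and A_hat: "(1 / cnj a)\<^sup>2 * s (Aff (1 / cnj a)) = h (e_op (circle_refl (Aff (1 / cnj a))) \<phi>) \<psi> \<longleftrightarrow> adj a"
    if "a \<noteq> 0" "norm a < 1" for a
    using that unfolding adj by (auto simp: sA norm_divide t_def power_divide)
  have pts: "(\<forall>b. norm b > 1 \<longrightarrow> P b) \<longleftrightarrow> (\<forall>a. norm a < 1 \<and> a \<noteq> 0 \<longrightarrow> P (1 / cnj a))" for P :: "complex \<Rightarrow> bool"
  proof (intro iffI allI impI)
    fix b :: complex assume *: "\<forall>a. norm a < 1 \<and> a \<noteq> 0 \<longrightarrow> P (1 / cnj a)" "norm b > 1"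
    then have "b \<noteq> 0" by auto
    with *(2) have "norm (1 / cnj b) < 1" by (simp add: norm_divide divide_less_eq)
    then show "P b" using *(1)[rule_format, of "1 / cnj b"] \<open>b \<noteq> 0\<close> by simp
  qed (auto simp: norm_divide)
  show "cond_i_hat h \<phi> \<psi> \<longleftrightarrow> cond_e_hat h \<psi> \<phi>"
    unfolding cond_i_hat_def Aff_in_disc' pts cond_e_hat_iff adj_def[symmetric]
    using A_hat unfolding s_def by blast
  have "(\<forall>z\<in>disc'. s z = t z) \<longleftrightarrow> s Infty = t Infty \<and> (\<forall>b. norm b > 1 \<longrightarrow> s (Aff b) = t (Aff b))"
    using Aff_in_disc' Infty_in_disc' by (metis pline.exhaust)
  also have "\<dots> \<longleftrightarrow> (\<forall>a. norm a < 1 \<longrightarrow> adj a)"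
    unfolding pts I using A by (metis norm_zero zero_less_one)
  also have "\<dots> \<longleftrightarrow> cond_e h \<psi> \<phi>"
    by (simp add: cond_e_iff adj_def)
  finally have eq: "(\<forall>z\<in>disc'. s z = t z) \<longleftrightarrow> cond_e h \<psi> \<phi>" .
  let ?J = "\<lambda>w. h \<phi> (eval_contract w \<psi>)"
  have J: "?J analytic_on ball 0 1"
    using eval_contract_holomorphic[OF clinear_right] by (simp add: analytic_on_open)
  have "meromorphic_section disc' s"
    unfolding meromorphic_section_def
  proof (intro conjI impI)
    have "(\<lambda>b. ?J (1 / b) / b\<^sup>2) analytic_on {b}" if "norm b > 1" for b
    proof -
      have "?J analytic_on {1 / b}"
        using that by (intro analytic_on_subset[OF J]) (auto simp: norm_divide divide_less_eq)
      then have "(\<lambda>x. ?J (1 / x)) analytic_on {b}"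
        using that by (intro analytic_at_one_over) auto
      then show ?thesis using that by (intro analytic_intros) auto
    qed
    then have "(\<lambda>b. ?J (1 / b) / b\<^sup>2) analytic_on {b. norm b > 1}"
      by (subst analytic_on_analytic_at) auto
    then have "(\<lambda>b. ?J (1 / b) / b\<^sup>2) holomorphic_on {b. norm b > 1}"
      by (rule analytic_imp_holomorphic)
    then have "(\<lambda>a. s (Aff a)) holomorphic_on {b. norm b > 1}"
      by (subst holomorphic_cong[OF refl]) (auto simp: sA)
    moreover have "open {b::complex. norm b > 1}"
      by (intro open_Collect_less continuous_intros)
    ultimately have "(\<lambda>a. s (Aff a)) analytic_on {b. norm b > 1}"
      by (simp add: analytic_on_open)
    then show "(\<lambda>a. s (Aff a)) meromorphic_on {a. Aff a \<in> disc'}"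
      by (simp add: Aff_in_disc' analytic_on_imp_meromorphic_on)
    have "chart_inf (\<lambda>a. s (Aff a)) w = - ?J w" if "w \<noteq> 0" "norm w < 1" for w
      using that by (simp add: chart_inf_def sA norm_divide power_divide)
    then have "\<forall>\<^sub>F w in at 0. chart_inf (\<lambda>a. s (Aff a)) w = - ?J w"
      unfolding eventually_at by (intro exI[of _ 1]) auto
    then have "chart_inf (\<lambda>a. s (Aff a)) meromorphic_on {0} \<longleftrightarrow> (\<lambda>w. - ?J w) meromorphic_on {0}"
      by (intro meromorphic_on_cong) auto
    moreover have "(\<lambda>w. - ?J w) analytic_on {0}"
      by (intro analytic_intros analytic_on_subset[OF J]) auto
    ultimately show "chart_inf (\<lambda>a. s (Aff a)) meromorphic_on {0}"
      using analytic_on_imp_meromorphic_on by blast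
  qed
  then show "cond_i h \<phi> \<psi> \<longleftrightarrow> cond_e h \<psi> \<phi>"
    using meromorphic_section_disc'_cong[of s t]
    unfolding cond_i_def section_eq_def eq[symmetric] s_def t_def by blast
qed

end

section \<open>Uniqueness\<close>

text \<open>
  Pairings with \<open>e\<^sub>a \<psi>\<close> for all \<open>a\<close> in the disc determine pairings with \<open>v \<psi>\<close> for all forms \<open>v\<close>:
  their Taylor coefficients are the pairings with \<open>e_form n a\<close>, and these forms span. The two sides
  may have different arguments \<open>\<phi>\<close> and \<open>\<psi>\<close>; comparing with \<open>\<phi>' = 0\<close> shows that a pairing vanishes.
\<close>

lemma pairing_gen_determined:
  assumes h: "hermitian_pairing h" and h': "hermitian_pairing h'"
    and eq: "\<And>a. norm a < 1 \<Longrightarrow> h \<phi> (e_coeff 0 a \<psi>) = h' \<phi>' (e_coeff 0 a \<psi>')"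
  shows "h \<phi> (sym_of v * \<psi>) = h' \<phi>' (sym_of v * \<psi>')"
proof -
  interpret h: hermitian_pairing h by (rule h)
  interpret h': hermitian_pairing h' by (rule h')
  show ?thesis
  proof (induction v rule: form_induct)
    case (e_form n a)
    let ?F = "Abs_fps (\<lambda>n. h \<phi> (e_coeff n a \<psi>))" and ?F' = "Abs_fps (\<lambda>n. h' \<phi>' (e_coeff n a \<psi>'))"
    have F: "(\<lambda>t. h \<phi> (e_coeff 0 (a + t) \<psi>)) has_fps_expansion ?F"
      and F': "(\<lambda>t. h' \<phi>' (e_coeff 0 (a + t) \<psi>')) has_fps_expansion ?F'"
      using h.pairs h'.pairs e_form unfolding pairs_e_sections_def by blast+
    have "\<forall>\<^sub>F t in nhds (0::complex). t \<in> ball 0 (1 - norm a)"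
      using e_form by (intro eventually_nhds_in_open) auto
    then have ev: "\<forall>\<^sub>F t in nhds 0. h \<phi> (e_coeff 0 (a + t) \<psi>) = h' \<phi>' (e_coeff 0 (a + t) \<psi>')"
    proof eventually_elim
      case (elim t)
      then have "norm (a + t) < 1" using norm_triangle_ineq[of a t] by simp
      then show ?case by (rule eq)
    qed
    have "?F = ?F'"
      by (rule fps_expansion_unique_complex[OF _ F'])
        (rule iffD1[OF has_fps_expansion_cong[OF ev refl] F])
    then have "fps_nth ?F n = fps_nth ?F' n" by simp
    then show ?case by (simp add: e_coeff_def)
  qed (simp_all add: sym_of_add sym_of_scale distrib_right cscale_times_left h.add_right h'.add_right
      h.scale_right h'.scale_right)
qed

lemma eval_contract_one: "norm w < 1 \<Longrightarrow> eval_contract w 1 = 0"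
  by (simp add: eval_contract_def contract_one clinear_inf_coeff)

text \<open>
  Condition (i) expresses the pairings with \<open>e\<^sub>a \<psi>\<close> by pairings with \<open>\<psi>\<close>, which lowers the degree
  of the second argument until it is \<open>1\<close>. Then the arguments are exchanged: \<open>(1, v \<phi>) = 0\<close> since
  contractions annihilate \<open>1\<close>.
\<close>

lemma fock_pairing_unique:
  assumes h: "hermitian_pairing h" "h 1 1 = 1" "\<And>\<phi> \<psi>. cond_e h \<phi> \<psi>"
    and h': "hermitian_pairing h'" "h' 1 1 = 1" "\<And>\<phi> \<psi>. cond_e h' \<phi> \<psi>"
  shows "h = h'"
proof -
  interpret h: hermitian_pairing h by (rule h)
  interpret h': hermitian_pairing h' by (rule h')
  have e: "h \<phi> (e_coeff 0 a \<psi>) = h (eval_contract (cnj a) \<phi>) \<psi>"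
    "h' \<phi> (e_coeff 0 a \<psi>) = h' (eval_contract (cnj a) \<phi>) \<psi>" if "norm a < 1" for \<phi> \<psi> a
    using that h(3) h'(3) by (auto simp: h.cond_e_iff h'.cond_e_iff)
  have vac: "k 1 (sym_of v * \<psi>) = 0"
    if k: "hermitian_pairing k" "\<And>\<phi> \<psi>. cond_e k \<phi> \<psi>" for k v \<psi>
  proof -
    interpret k: hermitian_pairing k by (rule k)
    have "k 1 (e_coeff 0 a \<psi>) = k 0 (e_coeff 0 a \<psi>)" if "norm a < 1" for a
      using that k(2)[of 1 \<psi>] by (simp add: k.cond_e_iff eval_contract_one k.zero_left)
    from pairing_gen_determined[OF k(1) k(1) this] show ?thesis
      by (simp add: k.zero_left)
  qed
  have "h \<phi> \<psi> = h' \<phi> \<psi>" for \<phi> \<psi>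
  proof (induction \<psi> arbitrary: \<phi> rule: symalg_induct)
    case one
    show ?case
    proof (induction \<phi> rule: symalg_induct)
      case (gen v \<phi>)
      have "h 1 (sym_of v * \<phi>) = 0" "h' 1 (sym_of v * \<phi>) = 0"
        using vac[OF h(1,3)] vac[OF h'(1,3)] by blast+
      then show ?case by (metis h.swap h'.swap)
    qed (simp_all add: h(2) h'(2) h.add_left h'.add_left h.scale_left h'.scale_left)
  next
    case (gen v \<psi>)
    show ?case
      by (rule pairing_gen_determined[OF h(1) h'(1)]) (simp add: e gen)
  qed (simp_all add: h.add_right h'.add_right h.scale_right h'.scale_right)
  then show ?thesis by (intro ext)
qed

section \<open>Existence\<close>

abbreviation fock_pairing :: "fock \<Rightarrow> fock \<Rightarrow> complex"
  where "fock_pairing \<equiv> form_space.fock_form"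

lemma fock_pairing_e:
  assumes "norm a < 1"
  shows "fock_pairing \<phi> (e_coeff 0 a \<psi>) = fock_pairing (eval_contract (cnj a) \<phi>) \<psi>"
proof -
  have "form_pairing (e_form 0 a) = (\<lambda>\<alpha>. inf_coeff \<alpha> (cnj a))"
    using form_pairing_e_form_inf_coeff[OF assms] form_space.herm
    by (metis (no_types, lifting) complex_cnj_cnj ext)
  then show ?thesis
    by (simp add: e_coeff_def form_space.fock_form_gen_right eval_contract_def)
qed

text \<open>
  Removing a factor \<open>v\<close> from the first argument splits the pairing with \<open>e_form n a\<close> into a pairing
  of one-forms and a pairing of lower degree, both of which have the expansion required.
\<close>

lemma fock_pairing_pairs_e_sections: "pairs_e_sections fock_pairing"
proof -
  note lin = form_space.lin
  have "(\<lambda>t. fock_pairing \<phi> (e_coeff 0 (a + t) \<psi>)) has_fps_expansion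
      Abs_fps (\<lambda>n. fock_pairing \<phi> (e_coeff n a \<psi>))" if a: "norm a < 1" for \<phi> \<psi> a
  proof (induction \<phi> arbitrary: \<psi> rule: symalg_induct)
    case one
    have "Abs_fps (\<lambda>n. 0) = (0 :: complex fps)" by (rule fps_ext) simp
    then show ?case by (simp add: e_coeff_def form_space.fock_form_one_left)
  next
    case (gen v \<phi>)
    have split: "fock_pairing (sym_of v * \<phi>) (e_coeff n z \<psi>) =
        form_pairing v (e_form n z) * fock_pairing \<phi> \<psi>
        + fock_pairing \<phi> (e_coeff n z (contract (form_pairing v) \<psi>))" for n z
      by (simp add: e_coeff_def form_space.fock_form_gen_left contract_gen lin
          form_space.fock_form_add_right form_space.fock_form_scale_right)
    have "Abs_fps (\<lambda>n. fock_pairing (sym_of v * \<phi>) (e_coeff n a \<psi>))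
        = Abs_fps (\<lambda>n. form_pairing v (e_form n a)) * fps_const (fock_pairing \<phi> \<psi>)
        + Abs_fps (\<lambda>n. fock_pairing \<phi> (e_coeff n a (contract (form_pairing v) \<psi>)))"
      by (rule fps_ext) (simp add: split)
    then show ?case
      unfolding split
      by (simp only:) (intro has_fps_expansion_add has_fps_expansion_cmult_right
          form_pairing_has_fps_expansion[OF a] gen)
  next
    case (add x y)
    have "Abs_fps (\<lambda>n. fock_pairing (x + y) (e_coeff n a \<psi>))
        = Abs_fps (\<lambda>n. fock_pairing x (e_coeff n a \<psi>)) + Abs_fps (\<lambda>n. fock_pairing y (e_coeff n a \<psi>))"
      by (rule fps_ext) (simp add: form_space.fock_form_add_left)
    then show ?case
      using has_fps_expansion_add[OF add.IH] by (simp add: form_space.fock_form_add_left)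
  next
    case (scale c x)
    have "Abs_fps (\<lambda>n. fock_pairing (c *\<^sub>C x) (e_coeff n a \<psi>))
        = fps_const (cnj c) * Abs_fps (\<lambda>n. fock_pairing x (e_coeff n a \<psi>))"
      by (rule fps_ext) (simp add: form_space.fock_form_scale_left)
    then show ?case
      using has_fps_expansion_cmult_left[OF scale.IH] by (simp add: form_space.fock_form_scale_left)
  qed
  then show ?thesis
    unfolding pairs_e_sections_def by blast
qed

lemma hermitian_pairing_fock_pairing: "hermitian_pairing fock_pairing"
proof
  show "hermitian_structure fock_pairing"
    unfolding hermitian_structure_def
    using form_space.fock_form_add_right form_space.fock_form_scale_right
      form_space.fock_form_add_left form_space.fock_form_scale_left form_space.fock_form_hermitian
    by blast
qed (rule fock_pairing_pairs_e_sections)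

theorem proposition7p6:
  "(\<exists>!h. hermitian_structure h \<and> pairs_e_sections h \<and> h 1 1 = 1 \<and>
      (\<forall>\<phi> \<psi>. cond_e h \<phi> \<psi> \<and> cond_i h \<phi> \<psi>)) \<and>
   (\<forall>h \<phi> \<psi>. hermitian_structure h \<and> pairs_e_sections h \<longrightarrow>
      (cond_e h \<phi> \<psi> \<longleftrightarrow> cond_e_hat h \<phi> \<psi>) \<and> (cond_i h \<phi> \<psi> \<longleftrightarrow> cond_i_hat h \<phi> \<psi>))"
proof (intro conjI allI impI)
  interpret F: hermitian_pairing fock_pairing by (rule hermitian_pairing_fock_pairing)
  have e: "cond_e fock_pairing \<phi> \<psi>" for \<phi> \<psi>
    by (simp add: F.cond_e_iff fock_pairing_e)
  show "\<exists>!h. hermitian_structure h \<and> pairs_e_sections h \<and> h 1 1 = 1 \<and>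
      (\<forall>\<phi> \<psi>. cond_e h \<phi> \<psi> \<and> cond_i h \<phi> \<psi>)"
  proof (rule ex1I[of _ fock_pairing])
    show "hermitian_structure fock_pairing \<and> pairs_e_sections fock_pairing \<and> fock_pairing 1 1 = 1 \<and>
        (\<forall>\<phi> \<psi>. cond_e fock_pairing \<phi> \<psi> \<and> cond_i fock_pairing \<phi> \<psi>)"
      by (simp add: F.hermitian F.pairs e F.cond_i_iff form_space.fock_form_one_left)
    show "h = fock_pairing" if "hermitian_structure h \<and> pairs_e_sections h \<and> h 1 1 = 1 \<and>
        (\<forall>\<phi> \<psi>. cond_e h \<phi> \<psi> \<and> cond_i h \<phi> \<psi>)" for h
      using that e hermitian_pairing_fock_pairing
      by (intro fock_pairing_unique) (auto simp: hermitian_pairing_def form_space.fock_form_one_left)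
  qed
next
  fix h \<phi> \<psi> assume "hermitian_structure h \<and> pairs_e_sections h"
  then interpret hermitian_pairing h by unfold_locales auto
  show "cond_e h \<phi> \<psi> \<longleftrightarrow> cond_e_hat h \<phi> \<psi>" "cond_i h \<phi> \<psi> \<longleftrightarrow> cond_i_hat h \<phi> \<psi>"
    by (simp_all only: cond_i_iff cond_i_hat_iff cond_e_iff_hat)
qed

end
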